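(* Let $(\mathbb{P},Act,\rightarrow)$ be an LTS with $Act=A\uplus\{\tau,t\}$. For all $P,Q\in\mathbb{P}$ and all $X\subseteq A$: (1) $P\simeq_{br}Q$ iff for all $\varphi\in\mathcal{L}^c_b$: $P\models\varphi\Leftrightarrow Q\models\varphi$; (2) $P\simeq^X_{br}Q$ iff for all $\varphi\in\mathcal{L}^c_b$: $P\models_X\varphi\Leftrightarrow Q\models_X\varphi$; (3) $P\simeq_{rbr}Q$ iff for all $\psi\in\mathcal{L}^{cr}_b$: $P\models\psi\Leftrightarrow Q\models\psi$; (4) $P\simeq^X_{rbr}Q$ iff for all $\psi\in\mathcal{L}^{cr}_b$: $P\models_X\psi\Leftrightarrow Q\models_X\psi$.
   Context: An LTS is $(\mathbb{P},Act,\rightarrow)$ with ${\rightarrow}\subseteq\mathbb{P}\times Act\times\mathbb{P}$, $Act=A\uplus\{\tau,t\}$ ($A$ visible actions, $\tau$ hidden action, $t$ time-out action); write $P\xrightarrow{\alpha}P'$. $A_\tau:=A\cup\{\tau\}$. $P\xrightarrow{(\alpha)}P'$ means ($\alpha=\tau$ and $P=P'$) or $P\xrightarrow{\alpha}P'$. $P\Longrightarrow P'$ is the reflexive-transitive closure of $\xrightarrow{\tau}$. $P\not\xrightarrow{\tau}$ means $P$ has no $\tau$-transition. $\mathcal{I}(P):=\{\alpha\in A_\tau\mid\exists Q.\,P\xrightarrow{\alpha}Q\}$. A concrete branching reactive bisimulation is a relation $\mathcal{R}\subseteq(\mathbb{P}\times\mathbb{P})\cup(\mathbb{P}\times\mathcal{P}(A)\times\mathbb{P})$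 that is symmetric ($\mathcal R(P,Q)\Leftrightarrow\mathcal R(Q,P)$ and $\mathcal R(P,X,Q)\Leftrightarrow\mathcal R(Q,X,P)$) such that for all $P,Q,X$: 1. if $\mathcal R(P,Q)$: (a) if $P\xrightarrow{\alpha}P'$, $\alpha\in A_\tau$, there is a path $Q\Longrightarrow Q_1\xrightarrow{(\alpha)}Q_2$ with $\mathcal R(P,Q_1)$, $\mathcal R(P',Q_2)$; (b) $\mathcal R(P,Y,Q)$ for all $Y\subseteq A$; 2. if $\mathcal R(P,X,Q)$: (a) if $P\xrightarrow{\tau}P'$ there is $Q\Longrightarrow Q_1\xrightarrow{(\tau)}Q_2$ with $\mathcal R(P,X,Q_1)$, $\mathcal R(P',X,Q_2)$; (b) if $P\xrightarrow{a}P'$ with $a\in X$ there is $Q\Longrightarrow Q_1\xrightarrow{a}Q_2$ with $\mathcal R(P,X,Q_1)$, $\mathcal R(P',Q_2)$; (c) if $\mathcal I(P)\cap(X\cup\{\tau\})=\emptyset$ there is $Q\Longrightarrow Q_0$ with $\mathcal R(P,Q_0)$; (d) if $\mathcal I(P)\cap(X\cup\{\tau\})=\emptyset$ and $P\xrightarrow{t}P'$ there is $Q\Longrightarrow Q_1\xrightarrow{t}Q_2$ with $\mathcal R(P',X,Q_2)$; (e) if $P\not\xrightarrow{\tau}$ there is $Q\Longrightarrow Q_0$ with $Q_0\not\xrightarrow{\tau}$. $P\simeq_{br}Q$ (resp. $P\simeq^X_{br}Q$) iff $\mathcal R(P,Q)$ (resp. $\mathcal R(P,X,Q)$) for some such $\mathcal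 R$. A rooted concrete branching reactive bisimulation is a symmetric relation of the same type with: 1. if $\mathcal R(P,Q)$: (a) if $P\xrightarrow{\alpha}P'$, $\alpha\in A_\tau$, then $Q\xrightarrow{\alpha}Q'$ for some $Q'$ with $P'\simeq_{br}Q'$; (b) $\mathcal R(P,Y,Q)$ for all $Y\subseteq A$; 2. if $\mathcal R(P,X,Q)$: (a) if $P\xrightarrow{\tau}P'$ then $Q\xrightarrow{\tau}Q'$ with $P'\simeq^X_{br}Q'$; (b) if $P\xrightarrow{a}P'$, $a\in X$, then $Q\xrightarrow{a}Q'$ with $P'\simeq_{br}Q'$; (c) if $\mathcal I(P)\cap(X\cup\{\tau\})=\emptyset$ then $\mathcal R(P,Q)$; (d) if $\mathcal I(P)\cap(X\cup\{\tau\})=\emptyset$ and $P\xrightarrow{t}P'$ then $Q\xrightarrow{t}Q'$ with $P'\simeq^X_{br}Q'$. $P\simeq_{rbr}Q$ (resp. $P\simeq^X_{rbr}Q$) iff $\mathcal R(P,Q)$ (resp. $\mathcal R(P,X,Q)$) for some such $\mathcal R$. Formulas: $\varphi::=\top\mid\bigwedge_{i\in I}\varphi_i\mid\neg\varphi\mid\langle\alpha\rangle\varphi\mid\langle X\rangle\varphi$ ($I$ any index set, $\alpha\in A_\tau$, $X\subseteq A$). Two satisfaction relations $\models$ and $\models_Y$ ($Y\subseteq A$): $\top$, $\bigwedge$, $\neg$ as usual for both; $P\models\langle\alpha\rangle\varphi$ iff $\exists P\xrightarrow{\alpha}P'$ with $P'\models\varphi$; $P\models_Y\langle\tau\rangle\varphi$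 iff $\exists P\xrightarrow{\tau}P'$ with $P'\models_Y\varphi$; $P\models_Y\langle a\rangle\varphi$ ($a\in A$) iff ($a\in Y$ or $\mathcal I(P)\cap(Y\cup\{\tau\})=\emptyset$) and $\exists P\xrightarrow{a}P'$ with $P'\models\varphi$; $P\models\langle X\rangle\varphi$ iff $\mathcal I(P)\cap(X\cup\{\tau\})=\emptyset$ and $\exists P\xrightarrow{t}P'$ with $P'\models_X\varphi$; $P\models_Y\langle X\rangle\varphi$ iff $\mathcal I(P)\cap(X\cup Y\cup\{\tau\})=\emptyset$ and $\exists P\xrightarrow{t}P'$ with $P'\models_X\varphi$. Derived: disjunction via $\neg\bigwedge\neg$; $\langle\epsilon\rangle\varphi:=\bigvee_{i\in\mathbb N}\langle\tau\rangle^i\varphi$; $\langle\hat\alpha\rangle\varphi:=\varphi\vee\langle\tau\rangle\varphi$ if $\alpha=\tau$, else $\langle\alpha\rangle\varphi$; $\varphi\langle\hat\alpha\rangle\varphi':=\varphi\wedge\langle\hat\alpha\rangle\varphi'$. $\mathcal L^c_b$: $\varphi::=\top\mid\bigwedge_{i\in I}\varphi_i\mid\neg\varphi\mid\langle\epsilon\rangle(\varphi\langle\hat\alpha\rangle\varphi')\mid\langle\epsilon\rangle\langle X\rangle\varphi'\mid\langle\epsilon\rangle\neg\langle\tau\rangle\top$ ($\alpha\in A_\tau$, $X\subseteq A$, $\varphi,\varphi'\in\mathcal L^c_b$). $\mathcal L^{cr}_b$: $\psi::=\top\mid\bigwedge_{i\in I}\psi_i\mid\neg\psi\mid\langle\alpha\rangle\varphi\mid\langle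 X\rangle\varphi$ with $\varphi\in\mathcal L^c_b$. *)

theory Defs
  imports Main
begin

datatype 'a act = Vis 'a | Tau | Timeout

text \<open>Conjunctions range over sets of indices from a type \<open>'i\<close>; only the values of the family
  on the index set matter. To render "any index set", instantiate \<open>'i\<close> with \<open>('j + 'p) + nat\<close>,
  where \<open>'j\<close> is arbitrary and \<open>'p\<close> is the type of states: with too few indices the logic could
  not characterise bisimilarity. \<open>Dia \<alpha>\<close> is meant for visible actions and \<open>Tau\<close> only: the
  languages below exclude \<open>Dia Timeout\<close>.\<close>

datatype ('a, 'i) fm =
    TT
  | Conj "'i set" "'i \<Rightarrow> ('a, 'i) fm"
  | Neg "('a, 'i) fm"
  | Dia "'a act" "('a, 'i) fm"
  | TDia "'a set" "('a, 'i) fm"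

definition Disj :: "'i set \<Rightarrow> ('i \<Rightarrow> ('a, 'i) fm) \<Rightarrow> ('a, 'i) fm" where
  "Disj I \<phi> = Neg (Conj I (\<lambda>i. Neg (\<phi> i)))"

text \<open>The derived operators need index sets \<open>{0, 1}\<close> and the natural numbers, so they live on
  formulas whose index type has a summand \<open>nat\<close>.\<close>

definition conj2 :: "('a, 'i + nat) fm \<Rightarrow> ('a, 'i + nat) fm \<Rightarrow> ('a, 'i + nat) fm" where
  "conj2 \<phi> \<psi> = Conj {Inr 0, Inr 1} (\<lambda>i. if i = Inr 0 then \<phi> else \<psi>)"

definition disj2 :: "('a, 'i + nat) fm \<Rightarrow> ('a, 'i + nat) fm \<Rightarrow> ('a, 'i + nat) fm" where
  "disj2 \<phi> \<psi> = Disj {Inr 0, Inr 1} (\<lambda>i. if i = Inr 0 then \<phi> else \<psi>)"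

definition Eps_Dia :: "('a, 'i + nat) fm \<Rightarrow> ('a, 'i + nat) fm" where
  "Eps_Dia \<phi> = Disj (range Inr) (\<lambda>i. (Dia Tau ^^ projr i) \<phi>)"

definition hat_Dia :: "'a act \<Rightarrow> ('a, 'i + nat) fm \<Rightarrow> ('a, 'i + nat) fm" where
  "hat_Dia \<alpha> \<phi> = (if \<alpha> = Tau then disj2 \<phi> (Dia Tau \<phi>) else Dia \<alpha> \<phi>)"

definition until :: "('a, 'i + nat) fm \<Rightarrow> 'a act \<Rightarrow> ('a, 'i + nat) fm \<Rightarrow> ('a, 'i + nat) fm" where
  "until \<phi> \<alpha> \<phi>' = conj2 \<phi> (hat_Dia \<alpha> \<phi>')"

locale lts =
  fixes A :: "'a set"
    and step :: "'p \<Rightarrow> 'a act \<Rightarrow> 'p \<Rightarrow> bool"  ("_ \<midarrow>_\<rightarrow> _" [60, 0, 60] 55)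
  assumes step_Act: "P \<midarrow>\<alpha>\<rightarrow> P' \<Longrightarrow> \<alpha> \<in> Vis ` A \<union> {Tau, Timeout}"
begin

definition A_tau :: "'a act set" where
  "A_tau = Vis ` A \<union> {Tau}"

definition opt_step :: "'p \<Rightarrow> 'a act \<Rightarrow> 'p \<Rightarrow> bool"  ("_ \<midarrow>'(_')\<rightarrow> _" [60, 0, 60] 55) where
  "P \<midarrow>(\<alpha>)\<rightarrow> P' \<longleftrightarrow> \<alpha> = Tau \<and> P = P' \<or> P \<midarrow>\<alpha>\<rightarrow> P'"

definition tau_path :: "'p \<Rightarrow> 'p \<Rightarrow> bool"  (infix "\<leadsto>" 55) where
  "P \<leadsto> P' \<longleftrightarrow> (\<lambda>R R'. R \<midarrow>Tau\<rightarrow> R')\<^sup>*\<^sup>* P P'"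

definition stable :: "'p \<Rightarrow> bool" where
  "stable P \<longleftrightarrow> (\<nexists>P'. P \<midarrow>Tau\<rightarrow> P')"

definition initials :: "'p \<Rightarrow> 'a act set" where
  "initials P = {\<alpha> \<in> A_tau. \<exists>Q. P \<midarrow>\<alpha>\<rightarrow> Q}"

definition idle :: "'p \<Rightarrow> 'a set \<Rightarrow> bool" where
  "idle P X \<longleftrightarrow> initials P \<inter> (Vis ` X \<union> {Tau}) = {}"

text \<open>A relation between states or triples is represented by its two parts: \<open>R\<close> for the pairs,
  \<open>S\<close> for the triples.\<close>

definition reactive_rel :: "('p \<Rightarrow> 'p \<Rightarrow> bool) \<Rightarrow> ('p \<Rightarrow> 'a set \<Rightarrow> 'p \<Rightarrow> bool) \<Rightarrow> bool" where
  "reactive_rel R S \<longleftrightarrow>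
     (\<forall>P X Q. S P X Q \<longrightarrow> X \<subseteq> A) \<and>
     (\<forall>P Q. R P Q \<longleftrightarrow> R Q P) \<and>
     (\<forall>P X Q. S P X Q \<longleftrightarrow> S Q X P)"

definition cbr_bisimulation ::
  "('p \<Rightarrow> 'p \<Rightarrow> bool) \<Rightarrow> ('p \<Rightarrow> 'a set \<Rightarrow> 'p \<Rightarrow> bool) \<Rightarrow> bool" where
  "cbr_bisimulation R S \<longleftrightarrow> reactive_rel R S \<and>
     (\<forall>P Q. R P Q \<longrightarrow>
        (\<forall>\<alpha>\<in>A_tau. \<forall>P'. P \<midarrow>\<alpha>\<rightarrow> P' \<longrightarrow>
           (\<exists>Q1 Q2. Q \<leadsto> Q1 \<and> Q1 \<midarrow>(\<alpha>)\<rightarrow> Q2 \<and> R P Q1 \<and> R P' Q2)) \<and>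
        (\<forall>Y\<subseteq>A. S P Y Q)) \<and>
     (\<forall>P X Q. S P X Q \<longrightarrow>
        (\<forall>P'. P \<midarrow>Tau\<rightarrow> P' \<longrightarrow>
           (\<exists>Q1 Q2. Q \<leadsto> Q1 \<and> Q1 \<midarrow>(Tau)\<rightarrow> Q2 \<and> S P X Q1 \<and> S P' X Q2)) \<and>
        (\<forall>a\<in>X. \<forall>P'. P \<midarrow>Vis a\<rightarrow> P' \<longrightarrow>
           (\<exists>Q1 Q2. Q \<leadsto> Q1 \<and> Q1 \<midarrow>Vis a\<rightarrow> Q2 \<and> S P X Q1 \<and> R P' Q2)) \<and>
        (idle P X \<longrightarrow> (\<exists>Q0. Q \<leadsto> Q0 \<and> R P Q0)) \<and>
        (\<forall>P'. idle P X \<and> P \<midarrow>Timeout\<rightarrow> P' \<longrightarrow>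
           (\<exists>Q1 Q2. Q \<leadsto> Q1 \<and> Q1 \<midarrow>Timeout\<rightarrow> Q2 \<and> S P' X Q2)) \<and>
        (stable P \<longrightarrow> (\<exists>Q0. Q \<leadsto> Q0 \<and> stable Q0)))"

definition br_bisim :: "'p \<Rightarrow> 'p \<Rightarrow> bool" where
  "br_bisim P Q \<longleftrightarrow> (\<exists>R S. cbr_bisimulation R S \<and> R P Q)"

definition br_bisim_env :: "'a set \<Rightarrow> 'p \<Rightarrow> 'p \<Rightarrow> bool" where
  "br_bisim_env X P Q \<longleftrightarrow> (\<exists>R S. cbr_bisimulation R S \<and> S P X Q)"

definition rooted_cbr_bisimulation ::
  "('p \<Rightarrow> 'p \<Rightarrow> bool) \<Rightarrow> ('p \<Rightarrow> 'a set \<Rightarrow> 'p \<Rightarrow> bool) \<Rightarrow> bool" where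
  "rooted_cbr_bisimulation R S \<longleftrightarrow> reactive_rel R S \<and>
     (\<forall>P Q. R P Q \<longrightarrow>
        (\<forall>\<alpha>\<in>A_tau. \<forall>P'. P \<midarrow>\<alpha>\<rightarrow> P' \<longrightarrow> (\<exists>Q'. Q \<midarrow>\<alpha>\<rightarrow> Q' \<and> br_bisim P' Q')) \<and>
        (\<forall>Y\<subseteq>A. S P Y Q)) \<and>
     (\<forall>P X Q. S P X Q \<longrightarrow>
        (\<forall>P'. P \<midarrow>Tau\<rightarrow> P' \<longrightarrow> (\<exists>Q'. Q \<midarrow>Tau\<rightarrow> Q' \<and> br_bisim_env X P' Q')) \<and>
        (\<forall>a\<in>X. \<forall>P'. P \<midarrow>Vis a\<rightarrow> P' \<longrightarrow> (\<exists>Q'. Q \<midarrow>Vis a\<rightarrow> Q' \<and> br_bisim P' Q')) \<and>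
        (idle P X \<longrightarrow> R P Q) \<and>
        (\<forall>P'. idle P X \<and> P \<midarrow>Timeout\<rightarrow> P' \<longrightarrow>
           (\<exists>Q'. Q \<midarrow>Timeout\<rightarrow> Q' \<and> br_bisim_env X P' Q')))"

definition rbr_bisim :: "'p \<Rightarrow> 'p \<Rightarrow> bool" where
  "rbr_bisim P Q \<longleftrightarrow> (\<exists>R S. rooted_cbr_bisimulation R S \<and> R P Q)"

definition rbr_bisim_env :: "'a set \<Rightarrow> 'p \<Rightarrow> 'p \<Rightarrow> bool" where
  "rbr_bisim_env X P Q \<longleftrightarrow> (\<exists>R S. rooted_cbr_bisimulation R S \<and> S P X Q)"

text \<open>The two satisfaction relations are mutually recursive. They are defined as one primitive
  recursive function with a mode argument: \<open>None\<close> gives \<open>\<Turnstile>\<close> and \<open>Some Y\<close> gives \<open>\<Turnstile>\<^sub>Y\<close>. The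
  individual clauses are derived in \<open>sat_clauses\<close> and \<open>sat_env_clauses\<close>.\<close>

primrec sem :: "('a, 'i) fm \<Rightarrow> 'a set option \<Rightarrow> 'p \<Rightarrow> bool" where
  "sem TT m P \<longleftrightarrow> True"
| "sem (Conj I \<phi>) m P \<longleftrightarrow> (\<forall>i\<in>I. sem (\<phi> i) m P)"
| "sem (Neg \<phi>) m P \<longleftrightarrow> \<not> sem \<phi> m P"
| "sem (Dia \<alpha> \<phi>) m P \<longleftrightarrow>
     (case m of
        None \<Rightarrow> (\<exists>P'. P \<midarrow>\<alpha>\<rightarrow> P' \<and> sem \<phi> None P')
      | Some Y \<Rightarrow>
          (if \<alpha> = Tau then (\<exists>P'. P \<midarrow>Tau\<rightarrow> P' \<and> sem \<phi> (Some Y) P')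
           else (\<alpha> \<in> Vis ` Y \<or> idle P Y) \<and> (\<exists>P'. P \<midarrow>\<alpha>\<rightarrow> P' \<and> sem \<phi> None P')))"
| "sem (TDia X \<phi>) m P \<longleftrightarrow>
     (case m of
        None \<Rightarrow> idle P X \<and> (\<exists>P'. P \<midarrow>Timeout\<rightarrow> P' \<and> sem \<phi> (Some X) P')
      | Some Y \<Rightarrow> idle P (X \<union> Y) \<and> (\<exists>P'. P \<midarrow>Timeout\<rightarrow> P' \<and> sem \<phi> (Some X) P'))"

definition sat :: "'p \<Rightarrow> ('a, 'i) fm \<Rightarrow> bool" where
  "sat P \<phi> \<longleftrightarrow> sem \<phi> None P"

definition sat_env :: "'a set \<Rightarrow> 'p \<Rightarrow> ('a, 'i) fm \<Rightarrow> bool" where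
  "sat_env Y P \<phi> \<longleftrightarrow> sem \<phi> (Some Y) P"

lemma sat_clauses:
  "sat P TT"
  "sat P (Conj I \<Phi>) \<longleftrightarrow> (\<forall>i\<in>I. sat P (\<Phi> i))"
  "sat P (Neg \<phi>) \<longleftrightarrow> \<not> sat P \<phi>"
  "sat P (Dia \<alpha> \<phi>) \<longleftrightarrow> (\<exists>P'. P \<midarrow>\<alpha>\<rightarrow> P' \<and> sat P' \<phi>)"
  "sat P (TDia X \<phi>) \<longleftrightarrow> idle P X \<and> (\<exists>P'. P \<midarrow>Timeout\<rightarrow> P' \<and> sat_env X P' \<phi>)"
  by (simp_all add: sat_def sat_env_def)

lemma sat_env_clauses:
  "sat_env Y P TT"
  "sat_env Y P (Conj I \<Phi>) \<longleftrightarrow> (\<forall>i\<in>I. sat_env Y P (\<Phi> i))"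
  "sat_env Y P (Neg \<phi>) \<longleftrightarrow> \<not> sat_env Y P \<phi>"
  "sat_env Y P (Dia Tau \<phi>) \<longleftrightarrow> (\<exists>P'. P \<midarrow>Tau\<rightarrow> P' \<and> sat_env Y P' \<phi>)"
  "sat_env Y P (Dia (Vis a) \<phi>) \<longleftrightarrow>
     (a \<in> Y \<or> idle P Y) \<and> (\<exists>P'. P \<midarrow>Vis a\<rightarrow> P' \<and> sat P' \<phi>)"
  "sat_env Y P (TDia X \<phi>) \<longleftrightarrow>
     idle P (X \<union> Y) \<and> (\<exists>P'. P \<midarrow>Timeout\<rightarrow> P' \<and> sat_env X P' \<phi>)"
  by (auto simp: sat_def sat_env_def)

inductive_set Lcb :: "('a, 'i + nat) fm set" where
  TT: "TT \<in> Lcb"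
| Conj: "(\<And>i. i \<in> I \<Longrightarrow> \<Phi> i \<in> Lcb) \<Longrightarrow> Conj I \<Phi> \<in> Lcb"
| Neg: "\<phi> \<in> Lcb \<Longrightarrow> Neg \<phi> \<in> Lcb"
| Until: "\<alpha> \<in> A_tau \<Longrightarrow> \<phi> \<in> Lcb \<Longrightarrow> \<phi>' \<in> Lcb \<Longrightarrow> Eps_Dia (until \<phi> \<alpha> \<phi>') \<in> Lcb"
| TDia: "X \<subseteq> A \<Longrightarrow> \<phi>' \<in> Lcb \<Longrightarrow> Eps_Dia (TDia X \<phi>') \<in> Lcb"
| Stable: "Eps_Dia (Neg (Dia Tau TT)) \<in> Lcb"

inductive_set Lcrb :: "('a, 'i + nat) fm set" where
  TT: "TT \<in> Lcrb"
| Conj: "(\<And>i. i \<in> I \<Longrightarrow> \<Psi> i \<in> Lcrb) \<Longrightarrow> Conj I \<Psi> \<in> Lcrb"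
| Neg: "\<psi> \<in> Lcrb \<Longrightarrow> Neg \<psi> \<in> Lcrb"
| Dia: "\<alpha> \<in> A_tau \<Longrightarrow> \<phi> \<in> Lcb \<Longrightarrow> Dia \<alpha> \<phi> \<in> Lcrb"
| TDia: "X \<subseteq> A \<Longrightarrow> \<phi> \<in> Lcb \<Longrightarrow> TDia X \<phi> \<in> Lcrb"

end

end

theory Submission
  imports Defs
begin

text \<open>
  Soundness is an induction on formulas. The delicate case is a transition that an environment
  allowing \<open>X\<close> admits only because the state \<open>P\<close> is idle: clauses 2c and 2e then let the other
  side reach a stable state \<open>Q0\<close> that is related to \<open>P\<close> without an environment, and as \<open>P\<close> is
  stable too, \<open>Q0\<close> is also idle and answers strongly.

  For completeness, logical equivalence is itself a bisimulation. With conjunctions indexed by states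
  each state has a characteristic formula, and this yields all clauses whose conclusion is a
  matching transition. The remaining clauses, 1b and 2c, compare the two satisfaction relations and
  are again inductions on formulas. They rest on passing to
  stable states in the same way.
\<close>

context lts
begin

section \<open>Paths of hidden steps, stability and idleness\<close>

lemma tau_path_refl [simp]: "P \<leadsto> P"
  by (simp add: tau_path_def)

lemma tau_path_trans: "P \<leadsto> Q \<Longrightarrow> Q \<leadsto> T \<Longrightarrow> P \<leadsto> T"
  by (simp add: tau_path_def)

lemma tau_path_step: "P \<leadsto> Q \<Longrightarrow> Q \<midarrow>Tau\<rightarrow> T \<Longrightarrow> P \<leadsto> T"
  unfolding tau_path_def by (rule rtranclp.rtrancl_into_rtrancl)

lemma opt_step_Vis: "P \<midarrow>(Vis a)\<rightarrow> Q \<longleftrightarrow> P \<midarrow>Vis a\<rightarrow> Q"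
  by (simp add: opt_step_def)

lemma tau_path_opt_step: "P \<leadsto> Q \<Longrightarrow> Q \<midarrow>(Tau)\<rightarrow> T \<Longrightarrow> P \<leadsto> T"
  by (auto simp: opt_step_def intro: tau_path_step)

lemma tau_path_induct [consumes 1, case_names refl step]:
  assumes "P \<leadsto> Q" "H P" "\<And>T U. P \<leadsto> T \<Longrightarrow> T \<midarrow>Tau\<rightarrow> U \<Longrightarrow> H T \<Longrightarrow> H U"
  shows "H Q"
  using assms(1) unfolding tau_path_def
  by (induction rule: rtranclp_induct) (auto simp: assms(2) intro: assms(3)[unfolded tau_path_def])

lemma tau_path_stable: "P \<leadsto> Q \<Longrightarrow> stable P \<Longrightarrow> Q = P"
  unfolding tau_path_def stable_def by (metis converse_rtranclpE)

lemma visible_step_in_A: "P \<midarrow>Vis a\<rightarrow> P' \<Longrightarrow> a \<in> A"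
  using step_Act by fastforce

lemma A_tau_cases:
  assumes "\<alpha> \<in> A_tau"
  obtains "\<alpha> = Tau" | a where "\<alpha> = Vis a" "a \<in> A"
  using assms by (auto simp: A_tau_def)

text \<open>By \<open>visible_step_in_A\<close> the label of every visible step lies in
  \<open>A_tau\<close>, so the intersection with \<open>initials\<close> can be read off the steps
  themselves.\<close>

lemma idle_iff: "idle P X \<longleftrightarrow> stable P \<and> (\<forall>a\<in>X. \<forall>P'. \<not> P \<midarrow>Vis a\<rightarrow> P')"
  by (auto simp: idle_def initials_def stable_def A_tau_def dest: visible_step_in_A)

lemma idle_stable: "idle P X \<Longrightarrow> stable P"
  by (simp add: idle_iff)

lemma idle_Un: "idle P (X \<union> Y) \<longleftrightarrow> idle P X \<and> idle P Y"
  by (auto simp: idle_iff)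

text \<open>\<open>allowed\<close> and \<open>idle_in\<close> isolate the side conditions of the two
  kinds of diamonds. With them both satisfaction relations obey the same clauses, and one argument
  in a mode \<open>m\<close> covers both.\<close>

definition allowed :: "'a set option \<Rightarrow> 'a \<Rightarrow> 'p \<Rightarrow> bool" where
  "allowed m a P \<longleftrightarrow> (case m of None \<Rightarrow> True | Some Y \<Rightarrow> a \<in> Y \<or> idle P Y)"

lemma allowed_simps [simp]:
  "allowed None a P"
  "allowed (Some Y) a P \<longleftrightarrow> a \<in> Y \<or> idle P Y"
  by (simp_all add: allowed_def)

definition idle_in :: "'a set option \<Rightarrow> 'a set \<Rightarrow> 'p \<Rightarrow> bool" where
  "idle_in m X P \<longleftrightarrow> (case m of None \<Rightarrow> idle P X | Some Y \<Rightarrow> idle P (X \<union> Y))"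

lemma idle_in_simps [simp]:
  "idle_in None X P \<longleftrightarrow> idle P X"
  "idle_in (Some Y) X P \<longleftrightarrow> idle P X \<and> idle P Y"
  by (simp_all add: idle_in_def idle_Un)

lemma sem_Dia_Tau: "sem (Dia Tau \<phi>) m P \<longleftrightarrow> (\<exists>P'. P \<midarrow>Tau\<rightarrow> P' \<and> sem \<phi> m P')"
  by (cases m) auto

lemma sem_Dia_Vis:
  "sem (Dia (Vis a) \<phi>) m P \<longleftrightarrow> allowed m a P \<and> (\<exists>P'. P \<midarrow>Vis a\<rightarrow> P' \<and> sem \<phi> None P')"
  by (cases m) auto

lemma sem_TDia:
  "sem (TDia X \<phi>) m P \<longleftrightarrow> idle_in m X P \<and> (\<exists>P'. P \<midarrow>Timeout\<rightarrow> P' \<and> sem \<phi> (Some X) P')"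
  by (cases m) (auto simp: idle_Un)

declare sem.simps(4,5) [simp del]

lemma sem_Disj [simp]: "sem (Disj I \<phi>) m P \<longleftrightarrow> (\<exists>i\<in>I. sem (\<phi> i) m P)"
  by (simp add: Disj_def)

lemma sem_conj2 [simp]: "sem (conj2 \<phi> \<psi>) m P \<longleftrightarrow> sem \<phi> m P \<and> sem \<psi> m P"
  by (auto simp: conj2_def)

lemma sem_disj2 [simp]: "sem (disj2 \<phi> \<psi>) m P \<longleftrightarrow> sem \<phi> m P \<or> sem \<psi> m P"
  by (auto simp: disj2_def)

lemma sem_Dia_Tau_funpow:
  "sem ((Dia Tau ^^ n) \<phi>) m P \<longleftrightarrow> (\<exists>P'. ((\<lambda>R R'. R \<midarrow>Tau\<rightarrow> R') ^^ n) P P' \<and> sem \<phi> m P')"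
proof (induction n arbitrary: P)
  case (Suc n)
  \<comment> \<open>A relational power splits off its last step by definition, but the outermost
    diamond describes the first one. Hence the unrolling at the front.\<close>
  have "((\<lambda>R R'. R \<midarrow>Tau\<rightarrow> R') ^^ Suc n) P P' \<longleftrightarrow>
      (\<exists>T. P \<midarrow>Tau\<rightarrow> T \<and> ((\<lambda>R R'. R \<midarrow>Tau\<rightarrow> R') ^^ n) T P')" for P'
    using relpowp_Suc_D2 relpowp_Suc_I2 by metis
  with Suc show ?case by (auto simp: sem_Dia_Tau)
qed simp

lemma sem_Eps_Dia: "sem (Eps_Dia \<phi>) m P \<longleftrightarrow> (\<exists>P'. P \<leadsto> P' \<and> sem \<phi> m P')"
  by (auto simp: Eps_Dia_def sem_Dia_Tau_funpow tau_path_def rtranclp_power)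

lemma sem_Eps_Dia_stable: "stable P \<Longrightarrow> sem (Eps_Dia \<phi>) m P \<longleftrightarrow> sem \<phi> m P"
  unfolding sem_Eps_Dia using tau_path_stable tau_path_refl by blast

lemma sem_until_Tau:
  "sem (until \<phi> Tau \<phi>') m P \<longleftrightarrow> sem \<phi> m P \<and> (\<exists>P'. P \<midarrow>(Tau)\<rightarrow> P' \<and> sem \<phi>' m P')"
  by (auto simp: until_def hat_Dia_def sem_Dia_Tau opt_step_def)

lemma sem_until_Vis:
  "sem (until \<phi> (Vis a) \<phi>') m P \<longleftrightarrow>
     sem \<phi> m P \<and> allowed m a P \<and> (\<exists>P'. P \<midarrow>Vis a\<rightarrow> P' \<and> sem \<phi>' None P')"
  by (auto simp: until_def hat_Dia_def sem_Dia_Vis)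

lemma sem_stable: "sem (Eps_Dia (Neg (Dia Tau TT))) m P \<longleftrightarrow> (\<exists>P'. P \<leadsto> P' \<and> stable P')"
  by (simp add: sem_Eps_Dia sem_Dia_Tau stable_def)

subsection \<open>Matching of transitions\<close>

text \<open>This and the next two definitions turn the clauses on hidden steps, visible steps and
  stability into properties of single relations, so that the same lemmas serve a given bisimulation
  and logical equivalence.\<close>

definition tau_sim :: "('p \<Rightarrow> 'p \<Rightarrow> bool) \<Rightarrow> bool" where
  "tau_sim B \<longleftrightarrow> (\<forall>P Q. B P Q \<longrightarrow> (\<forall>P'. P \<midarrow>Tau\<rightarrow> P' \<longrightarrow>
     (\<exists>Q1 Q2. Q \<leadsto> Q1 \<and> Q1 \<midarrow>(Tau)\<rightarrow> Q2 \<and> B P Q1 \<and> B P' Q2)))"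

definition vis_sim :: "'a set \<Rightarrow> ('p \<Rightarrow> 'p \<Rightarrow> bool) \<Rightarrow> ('p \<Rightarrow> 'p \<Rightarrow> bool) \<Rightarrow> bool" where
  "vis_sim X B R \<longleftrightarrow> (\<forall>P Q. B P Q \<longrightarrow> (\<forall>a\<in>X. \<forall>P'. P \<midarrow>Vis a\<rightarrow> P' \<longrightarrow>
     (\<exists>Q1 Q2. Q \<leadsto> Q1 \<and> Q1 \<midarrow>Vis a\<rightarrow> Q2 \<and> B P Q1 \<and> R P' Q2)))"

definition stable_sim :: "('p \<Rightarrow> 'p \<Rightarrow> bool) \<Rightarrow> bool" where
  "stable_sim B \<longleftrightarrow> (\<forall>P Q. B P Q \<longrightarrow> stable P \<longrightarrow> (\<exists>Q0. Q \<leadsto> Q0 \<and> stable Q0))"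

lemma tau_simD:
  assumes "tau_sim B" "B P Q" "P \<midarrow>(Tau)\<rightarrow> P'"
  shows "\<exists>Q1 Q2. Q \<leadsto> Q1 \<and> Q1 \<midarrow>(Tau)\<rightarrow> Q2 \<and> B P Q1 \<and> B P' Q2"
proof (cases "P = P'")
  case True
  then show ?thesis using assms(2) tau_path_refl opt_step_def by blast
next
  case False
  then show ?thesis using assms by (auto simp: opt_step_def tau_sim_def)
qed

lemma vis_simD:
  assumes "vis_sim X B R" "B P Q" "P \<midarrow>Vis a\<rightarrow> P'" "a \<in> X"
  shows "\<exists>Q1 Q2. Q \<leadsto> Q1 \<and> Q1 \<midarrow>Vis a\<rightarrow> Q2 \<and> B P Q1 \<and> R P' Q2"
  using assms unfolding vis_sim_def by blast

lemma tau_sim_path: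
  assumes "tau_sim B" "P \<leadsto> P'" "B P Q"
  shows "\<exists>Q'. Q \<leadsto> Q' \<and> B P' Q'"
  using assms(2)
proof (induction rule: tau_path_induct)
  case refl
  then show ?case using assms(3) tau_path_refl by blast
next
  case (step T U)
  then obtain Q' where "Q \<leadsto> Q'" "B T Q'" by blast
  moreover from this step obtain Q1 Q2 where "Q' \<leadsto> Q1" "Q1 \<midarrow>(Tau)\<rightarrow> Q2" "B U Q2"
    using assms(1) unfolding tau_sim_def by blast
  ultimately show ?case using tau_path_trans tau_path_opt_step by blast
qed

text \<open>By symmetry \<open>P\<close> has to mimic the path from \<open>Q\<close> to
  \<open>Q'\<close>, and a stable state can do so only by staying where it is.\<close>

lemma tau_sim_stable_path:
  assumes "symp B" "tau_sim B" "B P Q" "stable P" "Q \<leadsto> Q'"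
  shows "B P Q'"
  using tau_sim_path[OF assms(2,5) sympD[OF assms(1,3)]] tau_path_stable[OF _ assms(4)]
    sympD[OF assms(1)] by blast

text \<open>\<open>stable_sim\<close> promises a stable state without relating it to
  \<open>P\<close>; \<open>tau_sim_stable_path\<close> supplies the relation.\<close>

lemma stable_match:
  assumes "symp B" "tau_sim B" "stable_sim B" "B P Q" "stable P"
  shows "\<exists>Q0. Q \<leadsto> Q0 \<and> stable Q0 \<and> B P Q0"
  using assms tau_sim_stable_path unfolding stable_sim_def by blast

text \<open>A step of \<open>Q\<close> with label in \<open>X\<close> would be answered by
  \<open>P\<close> after a path that is empty because \<open>P\<close> is stable. So
  \<open>P\<close> itself would have a step with that label.\<close>

lemma idle_transfer:
  assumes "symp B" "vis_sim X B R" "B P Q" "idle P X" "stable Q"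
  shows "idle Q X"
proof -
  have "\<not> Q \<midarrow>Vis a\<rightarrow> Q'" if "a \<in> X" for a Q'
  proof
    assume "Q \<midarrow>Vis a\<rightarrow> Q'"
    then obtain P1 P2 where "P \<leadsto> P1" "P1 \<midarrow>Vis a\<rightarrow> P2"
      using vis_simD[OF assms(2) sympD[OF assms(1,3)]] \<open>a \<in> X\<close> by blast
    then show False
      using assms(4) \<open>a \<in> X\<close> tau_path_stable unfolding idle_iff by blast
  qed
  then show ?thesis using assms(5) by (simp add: idle_iff)
qed

lemma vis_sim_all: "vis_sim A B R \<Longrightarrow> vis_sim X B R"
  using visible_step_in_A unfolding vis_sim_def by blast

text \<open>As \<open>vis_sim A R R\<close> covers all labels, one stable \<open>Q0\<close> works
  for every environment \<open>Z\<close> at once. Time-outs inside an environment rely on this,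
  since they ask for idleness with respect to two sets.\<close>

lemma idle_match:
  assumes "symp R" "tau_sim R" "vis_sim A R R" "stable_sim R" "R P Q" "idle P X"
  shows "\<exists>Q0. Q \<leadsto> Q0 \<and> stable Q0 \<and> R P Q0 \<and> (\<forall>Z. idle P Z \<longrightarrow> idle Q0 Z)"
proof -
  obtain Q0 where "Q \<leadsto> Q0" "stable Q0" "R P Q0"
    using stable_match assms idle_stable by blast
  then show ?thesis using idle_transfer vis_sim_all assms(1,3) by blast
qed

lemma vis_sim_stable:
  assumes "vis_sim A B R" "B P Q" "stable Q" "P \<midarrow>Vis a\<rightarrow> P'"
  shows "\<exists>Q'. Q \<midarrow>Vis a\<rightarrow> Q' \<and> R P' Q'"
  using vis_simD[OF assms(1,2,4)] visible_step_in_A[OF assms(4)] tau_path_stable[OF _ assms(3)]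
  by blast

subsection \<open>Soundness\<close>

text \<open>The modes are those of \<open>sem\<close>, so a single induction on formulas treats
  pairs and triples.\<close>

definition mode_rel ::
  "('p \<Rightarrow> 'p \<Rightarrow> bool) \<Rightarrow> ('p \<Rightarrow> 'a set \<Rightarrow> 'p \<Rightarrow> bool) \<Rightarrow> 'a set option \<Rightarrow> 'p \<Rightarrow> 'p \<Rightarrow> bool" where
  "mode_rel R S m P Q \<longleftrightarrow> (case m of None \<Rightarrow> R P Q | Some X \<Rightarrow> S P X Q)"

lemma mode_rel_simps [simp]:
  "mode_rel R S None = R"
  "mode_rel R S (Some X) = (\<lambda>P Q. S P X Q)"
  by (auto simp: mode_rel_def fun_eq_iff)

lemma reactive_rel_iff:
  "reactive_rel R S \<longleftrightarrow> (\<forall>P X Q. S P X Q \<longrightarrow> X \<subseteq> A) \<and> (\<forall>m. symp (mode_rel R S m))"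
  unfolding reactive_rel_def symp_def by (auto simp: mode_rel_def split: option.split)

lemma cbr_bisimulation_iff:
  "cbr_bisimulation R S \<longleftrightarrow>
     (\<forall>P X Q. S P X Q \<longrightarrow> X \<subseteq> A) \<and>
     (\<forall>m. symp (mode_rel R S m)) \<and> (\<forall>m. tau_sim (mode_rel R S m)) \<and>
     vis_sim A R R \<and> (\<forall>X. vis_sim X (\<lambda>P Q. S P X Q) R) \<and>
     (\<forall>P Q. R P Q \<longrightarrow> (\<forall>Y\<subseteq>A. S P Y Q)) \<and>
     (\<forall>P X Q. S P X Q \<longrightarrow> idle P X \<longrightarrow> (\<exists>Q0. Q \<leadsto> Q0 \<and> R P Q0)) \<and>
     (\<forall>P X Q. S P X Q \<longrightarrow> (\<forall>P'. idle P X \<and> P \<midarrow>Timeout\<rightarrow> P' \<longrightarrow>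
        (\<exists>Q1 Q2. Q \<leadsto> Q1 \<and> Q1 \<midarrow>Timeout\<rightarrow> Q2 \<and> S P' X Q2))) \<and>
     (\<forall>X. stable_sim (\<lambda>P Q. S P X Q))"
proof -
  have R: "(\<forall>P Q. R P Q \<longrightarrow> (\<forall>\<alpha>\<in>A_tau. \<forall>P'. P \<midarrow>\<alpha>\<rightarrow> P' \<longrightarrow>
      (\<exists>Q1 Q2. Q \<leadsto> Q1 \<and> Q1 \<midarrow>(\<alpha>)\<rightarrow> Q2 \<and> R P Q1 \<and> R P' Q2))) \<longleftrightarrow> tau_sim R \<and> vis_sim A R R"
    unfolding tau_sim_def vis_sim_def A_tau_def
    by (simp add: ball_Un imp_conjR all_conj_distrib opt_step_Vis)
  have m: "(\<forall>m. tau_sim (mode_rel R S m)) \<longleftrightarrow> tau_sim R \<and> (\<forall>X. tau_sim (\<lambda>P Q. S P X Q))"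
    by (simp add: split_option_all)
  \<comment> \<open>The definition quantifies the environment between the states, whereas
    \<open>vis_sim\<close> and the other properties fix it first.\<close>
  have swap: "(\<forall>P X Q. F P X Q) \<longleftrightarrow> (\<forall>X P Q. F P X Q)" for F :: "'p \<Rightarrow> 'a set \<Rightarrow> 'p \<Rightarrow> bool"
    by blast
  show ?thesis
    unfolding cbr_bisimulation_def reactive_rel_iff m imp_conjR all_conj_distrib R
    unfolding tau_sim_def vis_sim_def stable_sim_def swap
    by (rule iffI; elim conjE; intro conjI; assumption)
qed

context
  fixes R S
  assumes bisim: "cbr_bisimulation R S"
begin

lemma S_env: "S P X Q \<Longrightarrow> X \<subseteq> A"
  using bisim[unfolded cbr_bisimulation_iff, THEN conjunct1] by blast

lemma bisim_clauses:
  shows bisim_symp: "symp (mode_rel R S m)"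
    and bisim_tau_sim: "tau_sim (mode_rel R S m)"
    and R_vis_sim: "vis_sim A R R"
    and S_vis_sim: "vis_sim X (\<lambda>P Q. S P X Q) R"
    and R_imp_S: "R P Q \<Longrightarrow> Y \<subseteq> A \<Longrightarrow> S P Y Q"
    and S_idle: "S P X Q \<Longrightarrow> idle P X \<Longrightarrow> \<exists>Q0. Q \<leadsto> Q0 \<and> R P Q0"
    and S_timeout: "S P X Q \<Longrightarrow> idle P X \<Longrightarrow> P \<midarrow>Timeout\<rightarrow> P' \<Longrightarrow>
      \<exists>Q1 Q2. Q \<leadsto> Q1 \<and> Q1 \<midarrow>Timeout\<rightarrow> Q2 \<and> S P' X Q2"
    and S_stable_sim: "stable_sim (\<lambda>P Q. S P X Q)"
  using bisim unfolding cbr_bisimulation_iff by simp_all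

text \<open>Clause 2e speaks of triples. Pairs inherit it through clause 1b, with \<open>{}\<close>
  as an environment that lies in \<open>A\<close> in any case.\<close>

lemma bisim_stable_sim: "stable_sim (mode_rel R S m)"
proof (cases m)
  case None
  have "stable_sim R"
    using S_stable_sim R_imp_S[of _ _ "{}"] unfolding stable_sim_def by blast
  with None show ?thesis by simp
qed (simp add: S_stable_sim)

lemma R_idle_match:
  assumes "R P Q" "idle P X"
  shows "\<exists>Q0. Q \<leadsto> Q0 \<and> stable Q0 \<and> R P Q0 \<and> (\<forall>Z. idle P Z \<longrightarrow> idle Q0 Z)"
  using idle_match[OF _ _ R_vis_sim _ assms] bisim_symp[of None] bisim_tau_sim[of None]
    bisim_stable_sim[of None] by simp

text \<open>For a label outside the environment no clause on triples applies directly; the step is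
  allowed because \<open>P\<close> is idle, and the answer comes from a stable state forming a pair
  with \<open>P\<close>.\<close>

lemma bisim_vis_match:
  assumes "mode_rel R S m P Q" "allowed m a P" "P \<midarrow>Vis a\<rightarrow> P'"
  shows "\<exists>Q1 Q2. Q \<leadsto> Q1 \<and> Q1 \<midarrow>Vis a\<rightarrow> Q2 \<and> mode_rel R S m P Q1 \<and> allowed m a Q1 \<and> R P' Q2"
proof (cases m)
  case None
  then show ?thesis using assms vis_simD[OF R_vis_sim] visible_step_in_A by simp
next
  case (Some X)
  then have S: "S P X Q" using assms(1) by simp
  show ?thesis
  proof (cases "a \<in> X")
    case True
    then show ?thesis using Some vis_simD[OF S_vis_sim, OF S assms(3)] by simp
  next
    case False
    then have "idle P X" using assms(2) Some by simp
    then obtain Q0 where Q0: "Q \<leadsto> Q0" "stable Q0" "R P Q0" "idle Q0 X"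
      using S_idle[OF S] R_idle_match tau_path_trans by meson
    moreover obtain Q2 where "Q0 \<midarrow>Vis a\<rightarrow> Q2" "R P' Q2"
      using vis_sim_stable[OF R_vis_sim Q0(3,2) assms(3)] by blast
    \<comment> \<open>Clause 1b turns the pair of \<open>P\<close> and \<open>Q0\<close> back into a
      triple; \<open>S_env\<close> provides the inclusion of the environment in
      \<open>A\<close>.\<close>
    ultimately show ?thesis
      using R_imp_S S_env[OF S] unfolding Some mode_rel_simps allowed_simps by blast
  qed
qed

text \<open>The set \<open>X\<close> of the formula may differ from the environment in
  \<open>m\<close>, and clause 2d says nothing on the idleness of \<open>Q1\<close>. Both are
  settled by a stable \<open>Q0\<close> paired with \<open>P\<close>: clause 1b gives the triple for
  \<open>X\<close>, and the path in 2d collapses, so \<open>Q1\<close> is \<open>Q0\<close>.\<close>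

lemma bisim_timeout_match:
  assumes "mode_rel R S m P Q" "idle_in m X P" "X \<subseteq> A" "P \<midarrow>Timeout\<rightarrow> P'"
  shows "\<exists>Q1 Q2. Q \<leadsto> Q1 \<and> Q1 \<midarrow>Timeout\<rightarrow> Q2 \<and> idle_in m X Q1 \<and> S P' X Q2"
proof -
  have idle: "idle P X" using assms(2) by (cases m) simp_all
  have "\<exists>Q0. Q \<leadsto> Q0 \<and> R P Q0"
  proof (cases m)
    case None
    then show ?thesis using assms(1) tau_path_refl unfolding None mode_rel_simps by blast
  next
    case (Some Y)
    then show ?thesis using assms(1,2) S_idle by simp
  qed
  then obtain Q0 where Q0: "Q \<leadsto> Q0" "stable Q0" "R P Q0" "\<And>Z. idle P Z \<Longrightarrow> idle Q0 Z"
    using R_idle_match idle tau_path_trans by meson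
  have "idle_in m X Q0" using assms(2) Q0(4) by (cases m) simp_all
  moreover obtain Q2 where "Q0 \<midarrow>Timeout\<rightarrow> Q2" "S P' X Q2"
    using S_timeout[OF R_imp_S[OF Q0(3) assms(3)] idle assms(4)] tau_path_stable[OF _ Q0(2)]
    by blast
  ultimately show ?thesis using Q0(1) by blast
qed

text \<open>One implication is enough, as the negation case applies the induction hypothesis to the
  swapped states. The mode is generalised because a visible step leads to \<open>None\<close> and a
  time-out to \<open>Some X\<close>.\<close>

lemma bisim_sem_imp:
  assumes "\<phi> \<in> Lcb" "mode_rel R S m P Q" "sem \<phi> m P"
  shows "sem \<phi> m Q"
  using assms
proof (induction \<phi> arbitrary: m P Q rule: Lcb.induct)
  case (Neg \<phi>)
  then show ?case using sympD[OF bisim_symp] unfolding sem.simps by blast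
next
  case (Until \<alpha> \<phi> \<phi>')
  then obtain P1 where P1: "P \<leadsto> P1" "sem (until \<phi> \<alpha> \<phi>') m P1"
    by (auto simp: sem_Eps_Dia)
  obtain Q1 where Q1: "Q \<leadsto> Q1" "mode_rel R S m P1 Q1"
    using tau_sim_path[OF bisim_tau_sim P1(1) Until.prems(1)] by blast
  from \<open>\<alpha> \<in> A_tau\<close> have "\<exists>Q'. Q1 \<leadsto> Q' \<and> sem (until \<phi> \<alpha> \<phi>') m Q'"
  proof (cases rule: A_tau_cases)
    case 1
    then obtain P2 where P2: "sem \<phi> m P1" "P1 \<midarrow>(Tau)\<rightarrow> P2" "sem \<phi>' m P2"
      using P1(2) by (auto simp: sem_until_Tau)
    obtain Q' Q2 where "Q1 \<leadsto> Q'" "Q' \<midarrow>(Tau)\<rightarrow> Q2" "mode_rel R S m P1 Q'" "mode_rel R S m P2 Q2"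
      using tau_simD[OF bisim_tau_sim Q1(2) P2(2)] by blast
    then show ?thesis
      using Until.IH(1)[of m P1 Q'] Until.IH(2)[of m P2 Q2] P2(1,3)
      unfolding 1 sem_until_Tau by blast
  next
    case (2 a)
    then obtain P2 where P2: "sem \<phi> m P1" "allowed m a P1" "P1 \<midarrow>Vis a\<rightarrow> P2" "sem \<phi>' None P2"
      using P1(2) by (auto simp: sem_until_Vis)
    then obtain Q' Q2 where "Q1 \<leadsto> Q'" "Q' \<midarrow>Vis a\<rightarrow> Q2" "mode_rel R S m P1 Q'"
        "allowed m a Q'" "R P2 Q2"
      using bisim_vis_match[OF Q1(2)] by blast
    then show ?thesis
      using Until.IH(1)[of m P1 Q'] Until.IH(2)[of None P2 Q2] P2(1,4)
      unfolding 2 sem_until_Vis mode_rel_simps by blast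
  qed
  then show ?case using tau_path_trans[OF Q1(1)] unfolding sem_Eps_Dia by blast
next
  case (TDia X \<phi>')
  then obtain P1 P2 where P: "P \<leadsto> P1" "idle_in m X P1" "P1 \<midarrow>Timeout\<rightarrow> P2" "sem \<phi>' (Some X) P2"
    by (auto simp: sem_Eps_Dia sem_TDia)
  obtain Q1 where Q1: "Q \<leadsto> Q1" "mode_rel R S m P1 Q1"
    using tau_sim_path[OF bisim_tau_sim P(1) TDia.prems(1)] by blast
  obtain Q' Q2 where "Q1 \<leadsto> Q'" "Q' \<midarrow>Timeout\<rightarrow> Q2" "idle_in m X Q'" "S P2 X Q2"
    using bisim_timeout_match[OF Q1(2) P(2) \<open>X \<subseteq> A\<close> P(3)] by blast
  then show ?case
    using TDia.IH[of "Some X" P2 Q2] P(4) tau_path_trans[OF Q1(1)]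
    unfolding sem_Eps_Dia sem_TDia mode_rel_simps by blast
next
  case Stable
  then obtain P1 where P1: "P \<leadsto> P1" "stable P1" by (auto simp: sem_stable)
  obtain Q1 where Q1: "Q \<leadsto> Q1" "mode_rel R S m P1 Q1"
    using tau_sim_path[OF bisim_tau_sim P1(1) Stable.prems(1)] by blast
  then obtain Q0 where "Q1 \<leadsto> Q0" "stable Q0"
    using P1(2) bisim_stable_sim[of m] unfolding stable_sim_def by blast
  then show ?case using tau_path_trans[OF Q1(1)] unfolding sem_stable by blast
qed auto

lemma bisim_sem: "\<phi> \<in> Lcb \<Longrightarrow> mode_rel R S m P Q \<Longrightarrow> sem \<phi> m P \<longleftrightarrow> sem \<phi> m Q"
  using bisim_sem_imp sympD[OF bisim_symp] by blast

end

subsection \<open>Completeness\<close>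

definition agree :: "('a, 'j) fm set \<Rightarrow> 'a set option \<Rightarrow> 'p \<Rightarrow> 'p \<Rightarrow> bool" where
  "agree L m P Q \<longleftrightarrow> (\<forall>\<phi>\<in>L. sem \<phi> m P \<longleftrightarrow> sem \<phi> m Q)"

lemma agreeD: "agree L m P Q \<Longrightarrow> \<phi> \<in> L \<Longrightarrow> sem \<phi> m P \<longleftrightarrow> sem \<phi> m Q"
  by (simp add: agree_def)

lemma agree_refl [simp]: "agree L m P P"
  by (simp add: agree_def)

lemma agree_sym: "agree L m P Q \<Longrightarrow> agree L m Q P"
  by (auto simp: agree_def)

lemma agree_symp: "symp (agree L m)"
  by (simp add: symp_def agree_sym)

text \<open>The conjunction has, for every state that disagrees with \<open>P\<close>, a conjunct
  that is true at \<open>P\<close> and false there.\<close>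

lemma characteristic_formula:
  fixes L :: "('a, ('i + 'p) + nat) fm set"
  assumes Conj: "\<And>I \<Phi>. (\<And>i. i \<in> I \<Longrightarrow> \<Phi> i \<in> L) \<Longrightarrow> Conj I \<Phi> \<in> L"
    and Neg: "\<And>\<phi>. \<phi> \<in> L \<Longrightarrow> Neg \<phi> \<in> L"
  obtains \<chi> where "\<chi> \<in> L" "\<And>Q. sem \<chi> m Q \<longleftrightarrow> agree L m P Q"
proof -
  \<comment> \<open>A distinguishing formula is negated where necessary to make it true at
    \<open>P\<close>.\<close>
  have "\<exists>d\<in>L. sem d m P \<and> \<not> sem d m Q" if "\<not> agree L m P Q" for Q
    using that Neg unfolding agree_def by (metis sem.simps(3))
  then obtain d where d: "\<And>Q. \<not> agree L m P Q \<Longrightarrow> d Q \<in> L \<and> sem (d Q) m P \<and> \<not> sem (d Q) m Q"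
    by metis
  \<comment> \<open>The summand \<open>'p\<close> of the index type holds the states:
    \<open>Inl (Inr Q)\<close> is the index belonging to \<open>Q\<close>, and the projections
    recover \<open>Q\<close>.\<close>
  define \<chi> where
    "\<chi> = Conj ((\<lambda>Q. Inl (Inr Q)) ` {Q. \<not> agree L m P Q}) (\<lambda>i. d (projr (projl i)))"
  have "\<chi> \<in> L" unfolding \<chi>_def by (rule Conj) (use d in auto)
  moreover have "sem \<chi> m Q" if "agree L m P Q" for Q
  proof -
    have "sem \<chi> m P" using d by (auto simp: \<chi>_def)
    then show ?thesis using agreeD[OF that \<open>\<chi> \<in> L\<close>] by simp
  qed
  moreover have "\<not> sem \<chi> m Q" if "\<not> agree L m P Q" for Q
    using d that by (auto simp: \<chi>_def)
  ultimately show ?thesis using that by blast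
qed

context
  fixes L :: "('a, ('i + 'p) + nat) fm set"
  defines L_def: "L \<equiv> Lcb"
begin

text \<open>The local name \<open>L\<close> pins the index type of the formulas to one that contains
  the states, as \<open>characteristic_formula\<close> requires.\<close>

lemma characteristic_Lcb: "\<exists>\<chi>\<in>L. \<forall>Q. sem \<chi> m Q \<longleftrightarrow> agree L m P Q"
  by (rule characteristic_formula[of L m P]) (auto simp: L_def intro: Lcb.Conj Lcb.Neg)

text \<open>With characteristic formulas of \<open>P\<close> and \<open>P'\<close> inserted, the
  until formula is true at \<open>P\<close> by the empty path, and its truth at \<open>Q\<close>
  spells out the required answer.\<close>

lemma agree_tau_sim: "tau_sim (agree L m)"
  unfolding tau_sim_def
proof (intro allI impI)
  fix P Q P' assume *: "agree L m P Q" "P \<midarrow>Tau\<rightarrow> P'"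
  obtain \<chi> where \<chi>: "\<chi> \<in> L" "\<And>Q. sem \<chi> m Q \<longleftrightarrow> agree L m P Q"
    using characteristic_Lcb by blast
  obtain \<chi>' where \<chi>': "\<chi>' \<in> L" "\<And>Q. sem \<chi>' m Q \<longleftrightarrow> agree L m P' Q"
    using characteristic_Lcb by blast
  have "Eps_Dia (until \<chi> Tau \<chi>') \<in> L"
    using \<chi>(1) \<chi>'(1) by (auto simp: L_def A_tau_def intro: Lcb.Until)
  moreover have "sem (Eps_Dia (until \<chi> Tau \<chi>')) m P"
    unfolding sem_Eps_Dia sem_until_Tau \<chi>(2) \<chi>'(2) using *(2) tau_path_refl agree_refl
    by (metis opt_step_def)
  ultimately have "sem (Eps_Dia (until \<chi> Tau \<chi>')) m Q"
    using agreeD[OF *(1)] by blast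
  then show "\<exists>Q1 Q2. Q \<leadsto> Q1 \<and> Q1 \<midarrow>(Tau)\<rightarrow> Q2 \<and> agree L m P Q1 \<and> agree L m P' Q2"
    unfolding sem_Eps_Dia sem_until_Tau \<chi>(2) \<chi>'(2) by blast
qed

text \<open>The second characteristic formula is taken in mode \<open>None\<close>, since a visible
  step ends the influence of the environment. That \<open>Q1\<close> allows \<open>a\<close> is part
  of the semantics of the diamond.\<close>

lemma agree_vis_match:
  assumes "agree L m P Q" "allowed m a P" "P \<midarrow>Vis a\<rightarrow> P'"
  shows "\<exists>Q1 Q2. Q \<leadsto> Q1 \<and> Q1 \<midarrow>Vis a\<rightarrow> Q2 \<and> agree L m P Q1 \<and> allowed m a Q1 \<and> agree L None P' Q2"
proof -
  obtain \<chi> where \<chi>: "\<chi> \<in> L" "\<And>Q. sem \<chi> m Q \<longleftrightarrow> agree L m P Q"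
    using characteristic_Lcb by blast
  obtain \<chi>' where \<chi>': "\<chi>' \<in> L" "\<And>Q. sem \<chi>' None Q \<longleftrightarrow> agree L None P' Q"
    using characteristic_Lcb by blast
  have "Eps_Dia (until \<chi> (Vis a) \<chi>') \<in> L"
    using \<chi>(1) \<chi>'(1) visible_step_in_A[OF assms(3)]
    by (auto simp: L_def A_tau_def intro: Lcb.Until)
  moreover have "sem (Eps_Dia (until \<chi> (Vis a) \<chi>')) m P"
    unfolding sem_Eps_Dia sem_until_Vis \<chi>(2) \<chi>'(2) using assms(2,3) tau_path_refl agree_refl
    by blast
  ultimately have "sem (Eps_Dia (until \<chi> (Vis a) \<chi>')) m Q"
    using agreeD[OF assms(1)] by blast
  then show ?thesis
    unfolding sem_Eps_Dia sem_until_Vis \<chi>(2) \<chi>'(2) by blast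
qed

lemma agree_timeout_match:
  assumes "agree L m P Q" "idle_in m X P" "X \<subseteq> A" "P \<midarrow>Timeout\<rightarrow> P'"
  shows "\<exists>Q1 Q2. Q \<leadsto> Q1 \<and> Q1 \<midarrow>Timeout\<rightarrow> Q2 \<and> idle_in m X Q1 \<and> agree L (Some X) P' Q2"
proof -
  obtain \<chi> where \<chi>: "\<chi> \<in> L" "\<And>Q. sem \<chi> (Some X) Q \<longleftrightarrow> agree L (Some X) P' Q"
    using characteristic_Lcb by blast
  have "Eps_Dia (TDia X \<chi>) \<in> L"
    using \<chi>(1) assms(3) by (auto simp: L_def intro: Lcb.TDia)
  moreover have "sem (Eps_Dia (TDia X \<chi>)) m P"
    unfolding sem_Eps_Dia sem_TDia \<chi>(2) using assms(2,4) tau_path_refl agree_refl by blast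
  ultimately have "sem (Eps_Dia (TDia X \<chi>)) m Q"
    using agreeD[OF assms(1)] by blast
  then show ?thesis
    unfolding sem_Eps_Dia sem_TDia \<chi>(2) by blast
qed

lemma agree_vis_sim: "vis_sim A (agree L None) (agree L None)"
  using agree_vis_match[of None] unfolding vis_sim_def by simp

lemma agree_env_vis_sim: "vis_sim X (agree L (Some X)) (agree L None)"
  using agree_vis_match[of "Some X"] unfolding vis_sim_def allowed_simps by blast

lemma agree_stable_sim: "stable_sim (agree L m)"
  using agreeD[of L m _ _ "Eps_Dia (Neg (Dia Tau TT))"] Lcb.Stable
  unfolding stable_sim_def sem_stable L_def by (metis tau_path_refl)

lemma agree_idle_match:
  assumes "agree L None P Q" "idle P X"
  shows "\<exists>Q0. Q \<leadsto> Q0 \<and> stable Q0 \<and> agree L None P Q0 \<and> (\<forall>Z. idle P Z \<longrightarrow> idle Q0 Z)"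
  using idle_match[OF agree_symp agree_tau_sim agree_vis_sim agree_stable_sim assms] .

text \<open>This is the core of clause 1b. Steps are matched by agreement without environment; the
  induction hypothesis serves only subformulas still evaluated under \<open>Y\<close>, while those
  behind a visible step or a time-out follow from agreement of the targets in the new mode.\<close>

lemma agree_imp_sem_env:
  assumes "\<phi> \<in> L" "agree L None P Q" "sem \<phi> (Some Y) P"
  shows "sem \<phi> (Some Y) Q"
  using assms unfolding L_def
proof (induction \<phi> arbitrary: P Q rule: Lcb.induct)
  case (Neg \<phi>)
  then show ?case using agree_sym[of Lcb] unfolding sem.simps by blast
next
  case (Until \<alpha> \<phi> \<phi>')
  note prems = Until.prems[folded L_def] and IH = Until.IH[folded L_def]
  obtain P1 where P1: "P \<leadsto> P1" "sem (until \<phi> \<alpha> \<phi>') (Some Y) P1"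
    using prems(2) by (auto simp: sem_Eps_Dia)
  obtain Q1 where Q1: "Q \<leadsto> Q1" "agree L None P1 Q1"
    using tau_sim_path[OF agree_tau_sim P1(1) prems(1)] by blast
  from \<open>\<alpha> \<in> A_tau\<close> have "\<exists>Q'. Q1 \<leadsto> Q' \<and> sem (until \<phi> \<alpha> \<phi>') (Some Y) Q'"
  proof (cases rule: A_tau_cases)
    case 1
    then obtain P2 where P2: "sem \<phi> (Some Y) P1" "P1 \<midarrow>(Tau)\<rightarrow> P2" "sem \<phi>' (Some Y) P2"
      using P1(2) by (auto simp: sem_until_Tau)
    obtain Q' Q2 where "Q1 \<leadsto> Q'" "Q' \<midarrow>(Tau)\<rightarrow> Q2" "agree L None P1 Q'" "agree L None P2 Q2"
      using tau_simD[OF agree_tau_sim Q1(2) P2(2)] by blast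
    then show ?thesis
      using IH(1)[of P1 Q'] IH(2)[of P2 Q2] P2(1,3) unfolding 1 sem_until_Tau by blast
  next
    case (2 a)
    then obtain P2 where P2: "sem \<phi> (Some Y) P1" "a \<in> Y \<or> idle P1 Y" "P1 \<midarrow>Vis a\<rightarrow> P2"
        "sem \<phi>' None P2"
      using P1(2) by (auto simp: sem_until_Vis)
    have "\<exists>Q' Q2. Q1 \<leadsto> Q' \<and> Q' \<midarrow>Vis a\<rightarrow> Q2 \<and> agree L None P1 Q' \<and> (a \<in> Y \<or> idle Q' Y) \<and>
        agree L None P2 Q2"
    proof (cases "a \<in> Y")
      case True
      then show ?thesis using agree_vis_match[OF Q1(2) _ P2(3)] by auto
    next
      \<comment> \<open>Only idleness of \<open>P1\<close> allows the step, so the answer must come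
        from a state that is idle too.\<close>
      case False
      then obtain Q' where Q': "Q1 \<leadsto> Q'" "stable Q'" "agree L None P1 Q'" "idle Q' Y"
        using agree_idle_match[OF Q1(2)] P2(2) by blast
      then show ?thesis using vis_sim_stable[OF agree_vis_sim Q'(3,2) P2(3)] by blast
    qed
    then obtain Q' Q2 where "Q1 \<leadsto> Q'" "Q' \<midarrow>Vis a\<rightarrow> Q2" "agree L None P1 Q'"
        "a \<in> Y \<or> idle Q' Y" "agree L None P2 Q2"
      by blast
    moreover from this have "sem \<phi>' None Q2"
      using agreeD[of L None P2 Q2 \<phi>'] P2(4) Until.hyps by (simp add: L_def)
    ultimately show ?thesis
      using IH(1)[of P1 Q'] P2(1) unfolding 2 sem_until_Vis allowed_simps by blast
  qed
  then show ?case using tau_path_trans[OF Q1(1)] unfolding sem_Eps_Dia by blast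
next
  case (TDia X \<phi>')
  note prems = TDia.prems[folded L_def]
  obtain P1 P2 where P: "P \<leadsto> P1" "idle P1 X" "idle P1 Y" "P1 \<midarrow>Timeout\<rightarrow> P2" "sem \<phi>' (Some X) P2"
    using prems(2) by (auto simp: sem_Eps_Dia sem_TDia)
  obtain Q1 where Q1: "Q \<leadsto> Q1" "agree L None P1 Q1"
    using tau_sim_path[OF agree_tau_sim P(1) prems(1)] by blast
  obtain Q' where Q': "Q1 \<leadsto> Q'" "stable Q'" "agree L None P1 Q'" "idle Q' X" "idle Q' Y"
    using agree_idle_match[OF Q1(2) P(2)] P(2,3) by blast
  obtain Q2 where "Q' \<midarrow>Timeout\<rightarrow> Q2" "agree L (Some X) P2 Q2"
    using agree_timeout_match[OF Q'(3) _ \<open>X \<subseteq> A\<close> P(4)] P(2) tau_path_stable[OF _ Q'(2)]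
    unfolding idle_in_simps by blast
  moreover from this have "sem \<phi>' (Some X) Q2"
    using agreeD[of L "Some X" P2 Q2 \<phi>'] P(5) TDia.hyps by (simp add: L_def)
  ultimately show ?case
    using tau_path_trans[OF Q1(1) Q'(1)] Q'(4,5)
    unfolding sem_Eps_Dia sem_TDia idle_in_simps by blast
next
  case Stable
  note prems = Stable.prems[folded L_def]
  obtain P1 where P1: "P \<leadsto> P1" "stable P1" using prems(2) by (auto simp: sem_stable)
  obtain Q1 where Q1: "Q \<leadsto> Q1" "agree L None P1 Q1"
    using tau_sim_path[OF agree_tau_sim P1(1) prems(1)] by blast
  then obtain Q0 where "Q1 \<leadsto> Q0" "stable Q0"
    using P1(2) agree_stable_sim[of None] unfolding stable_sim_def by blast
  then show ?case using tau_path_trans[OF Q1(1)] unfolding sem_stable by blast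
qed auto

lemma agree_imp_agree_env: "agree L None P Q \<Longrightarrow> agree L (Some Y) P Q"
  unfolding agree_def[of L "Some Y"] using agree_imp_sem_env agree_imp_sem_env[OF _ agree_sym]
  by blast

text \<open>This is the core of clause 2c. Both states are stable, so \<open>Eps_Dia\<close>
  collapses and the hypothesis applies again to the same two states. Idleness of \<open>P\<close>
  allows every visible step under \<open>X\<close>, so agreement under \<open>X\<close> already
  matches all of them. Assuming idleness of both states keeps the claim symmetric for the negation
  case.\<close>

lemma agree_env_imp_sem:
  assumes "\<phi> \<in> L" "agree L (Some X) P Q" "idle P X" "idle Q X" "sem \<phi> None P"
  shows "sem \<phi> None Q"
  using assms unfolding L_def
proof (induction \<phi> arbitrary: P Q rule: Lcb.induct)
  case (Neg \<phi>)
  then show ?case using agree_sym[of Lcb] unfolding sem.simps by blast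
next
  case (Until \<alpha> \<phi> \<phi>')
  note prems = Until.prems[folded L_def] and IH = Until.IH[folded L_def]
  have stable: "stable P" "stable Q" using prems(2,3) idle_stable by blast+
  have P: "sem (until \<phi> \<alpha> \<phi>') None P" using prems(4) stable by (simp add: sem_Eps_Dia_stable)
  from \<open>\<alpha> \<in> A_tau\<close> have "sem (until \<phi> \<alpha> \<phi>') None Q"
  proof (cases rule: A_tau_cases)
    case 1
    \<comment> \<open>A stable state takes an optional hidden step only by staying put.\<close>
    then have "sem \<phi> None P" "sem \<phi>' None P"
      using P stable(1) by (auto simp: sem_until_Tau opt_step_def stable_def)
    then show ?thesis using IH prems(1-3) unfolding 1 sem_until_Tau opt_step_def by blast
  next
    case (2 a)
    then obtain P2 where P2: "sem \<phi> None P" "P \<midarrow>Vis a\<rightarrow> P2" "sem \<phi>' None P2"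
      using P by (auto simp: sem_until_Vis)
    then obtain Q2 where "Q \<midarrow>Vis a\<rightarrow> Q2" "agree L None P2 Q2"
      using agree_vis_match[OF prems(1) _ P2(2)] prems(2) tau_path_stable[OF _ stable(2)]
      unfolding allowed_simps by blast
    moreover from this have "sem \<phi>' None Q2"
      using agreeD[of L None P2 Q2 \<phi>'] P2(3) Until.hyps by (simp add: L_def)
    ultimately show ?thesis using IH(1)[OF prems(1-3)] P2(1) 2 by (auto simp: sem_until_Vis)
  qed
  then show ?case using stable by (simp add: sem_Eps_Dia_stable)
next
  case (TDia Y \<phi>')
  note prems = TDia.prems[folded L_def]
  have stable: "stable P" "stable Q" using prems(2,3) idle_stable by blast+
  obtain P2 where P: "idle P Y" "P \<midarrow>Timeout\<rightarrow> P2" "sem \<phi>' (Some Y) P2"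
    using prems(4) stable by (auto simp: sem_Eps_Dia_stable sem_TDia)
  obtain Q2 where "Q \<midarrow>Timeout\<rightarrow> Q2" "idle Q Y" "agree L (Some Y) P2 Q2"
    using agree_timeout_match[OF prems(1) _ \<open>Y \<subseteq> A\<close> P(2)] P(1) prems(2)
      tau_path_stable[OF _ stable(2)] unfolding idle_in_simps by blast
  moreover from this have "sem \<phi>' (Some Y) Q2"
    using agreeD[of L "Some Y" P2 Q2 \<phi>'] P(3) TDia.hyps by (simp add: L_def)
  ultimately show ?case using stable by (auto simp: sem_Eps_Dia_stable sem_TDia)
next
  case Stable
  then show ?case using idle_stable tau_path_refl[of Q] unfolding sem_stable by blast
qed auto

lemma agree_env_idle:
  assumes "agree L (Some X) P Q" "idle P X"
  shows "\<exists>Q0. Q \<leadsto> Q0 \<and> agree L None P Q0"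
proof -
  obtain Q0 where Q0: "Q \<leadsto> Q0" "stable Q0" "agree L (Some X) P Q0"
    using stable_match[OF agree_symp agree_tau_sim agree_stable_sim assms(1)] assms(2) idle_stable
    by blast
  have "idle Q0 X"
    using idle_transfer[OF agree_symp agree_env_vis_sim Q0(3) assms(2) Q0(2)] .
  then have "agree L None P Q0"
    using agree_env_imp_sem[OF _ Q0(3) assms(2)] agree_env_imp_sem[OF _ agree_sym[OF Q0(3)] _ assms(2)]
    unfolding agree_def[of L None] by blast
  then show ?thesis using Q0(1) by blast
qed

lemma agree_cbr_bisimulation:
  "cbr_bisimulation (agree L None) (\<lambda>P X Q. X \<subseteq> A \<and> agree L (Some X) P Q)"
    (is "cbr_bisimulation ?R ?S")
proof -
  \<comment> \<open>The inclusion in \<open>A\<close> is built into the triples, as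
    \<open>reactive_rel\<close> demands; for other environments the relation is empty and its
    clauses hold vacuously.\<close>
  have mode: "mode_rel ?R ?S m =
      (if \<forall>Y. m = Some Y \<longrightarrow> Y \<subseteq> A then agree L m else (\<lambda>P Q. False))" for m
    by (cases m) (auto simp: fun_eq_iff)
  show ?thesis
    unfolding cbr_bisimulation_iff
  proof (intro conjI)
    show "\<forall>P X Q. ?S P X Q \<longrightarrow> X \<subseteq> A"
      by blast
    show "\<forall>m. symp (mode_rel ?R ?S m)"
      using agree_symp unfolding mode by (auto simp: symp_def)
    show "\<forall>m. tau_sim (mode_rel ?R ?S m)"
      using agree_tau_sim unfolding mode by (auto simp: tau_sim_def)
    show "vis_sim A ?R ?R"
      by (rule agree_vis_sim)
    show "\<forall>X. vis_sim X (\<lambda>P Q. ?S P X Q) ?R"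
      using agree_env_vis_sim unfolding vis_sim_def by blast
    show "\<forall>P Q. ?R P Q \<longrightarrow> (\<forall>Y\<subseteq>A. ?S P Y Q)"
      using agree_imp_agree_env by blast
    show "\<forall>P X Q. ?S P X Q \<longrightarrow> idle P X \<longrightarrow> (\<exists>Q0. Q \<leadsto> Q0 \<and> ?R P Q0)"
      using agree_env_idle by blast
    have "\<exists>Q1 Q2. Q \<leadsto> Q1 \<and> Q1 \<midarrow>Timeout\<rightarrow> Q2 \<and> ?S P' X Q2"
      if "?S P X Q" "idle P X" "P \<midarrow>Timeout\<rightarrow> P'" for P X Q P'
      using agree_timeout_match[of "Some X" P Q X P'] that by auto
    then show "\<forall>P X Q. ?S P X Q \<longrightarrow> (\<forall>P'. idle P X \<and> P \<midarrow>Timeout\<rightarrow> P' \<longrightarrow>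
        (\<exists>Q1 Q2. Q \<leadsto> Q1 \<and> Q1 \<midarrow>Timeout\<rightarrow> Q2 \<and> ?S P' X Q2))"
      by blast
    show "\<forall>X. stable_sim (\<lambda>P Q. ?S P X Q)"
      using agree_stable_sim unfolding stable_sim_def by blast
  qed
qed

lemma br_bisim_iff_agree: "br_bisim P Q \<longleftrightarrow> agree L None P Q"
proof
  assume "br_bisim P Q"
  then obtain R S where "cbr_bisimulation R S" "R P Q" unfolding br_bisim_def by blast
  then show "agree L None P Q"
    unfolding agree_def L_def by (intro ballI bisim_sem[of R S]) simp_all
next
  assume "agree L None P Q"
  then show "br_bisim P Q" using agree_cbr_bisimulation unfolding br_bisim_def by blast
qed

lemma br_bisim_env_iff_agree:
  assumes "X \<subseteq> A"
  shows "br_bisim_env X P Q \<longleftrightarrow> agree L (Some X) P Q"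
proof
  assume "br_bisim_env X P Q"
  then obtain R S where "cbr_bisimulation R S" "S P X Q" unfolding br_bisim_env_def by blast
  then show "agree L (Some X) P Q"
    unfolding agree_def L_def by (intro ballI bisim_sem[of R S]) simp_all
next
  assume "agree L (Some X) P Q"
  then show "br_bisim_env X P Q"
    using agree_cbr_bisimulation assms unfolding br_bisim_env_def by blast
qed

lemma br_bisim_imp_br_bisim_env: "br_bisim P Q \<Longrightarrow> Y \<subseteq> A \<Longrightarrow> br_bisim_env Y P Q"
  using br_bisim_iff_agree br_bisim_env_iff_agree agree_imp_agree_env by blast

end

subsection \<open>Rooted bisimilarity\<close>

text \<open>A hidden step keeps the mode, so this is the relation its targets must satisfy in the
  rooted clauses.\<close>

definition next_bisim :: "'a set option \<Rightarrow> 'p \<Rightarrow> 'p \<Rightarrow> bool" where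
  "next_bisim m P Q \<longleftrightarrow> (case m of None \<Rightarrow> br_bisim P Q | Some X \<Rightarrow> br_bisim_env X P Q)"

lemma next_bisim_simps [simp]:
  "next_bisim None = br_bisim"
  "next_bisim (Some X) = br_bisim_env X"
  by (auto simp: next_bisim_def fun_eq_iff)

lemma A_tau_iff [simp]:
  "Tau \<in> A_tau" "Vis a \<in> A_tau \<longleftrightarrow> a \<in> A" "Timeout \<notin> A_tau"
  by (auto simp: A_tau_def)

lemma next_bisim_sem:
  assumes "\<phi> \<in> Lcb" "next_bisim m P Q"
  shows "sem \<phi> m P \<longleftrightarrow> sem \<phi> m Q"
proof -
  obtain R S where "cbr_bisimulation R S" "mode_rel R S m P Q"
    using assms(2) by (cases m) (auto simp: br_bisim_def br_bisim_env_def)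
  then show ?thesis using bisim_sem assms(1) by blast
qed

lemma characteristic_next_bisim:
  assumes "\<And>X. m = Some X \<Longrightarrow> X \<subseteq> A"
  shows "\<exists>\<chi>\<in>(Lcb :: ('a, ('i + 'p) + nat) fm set). \<forall>Q. sem \<chi> m Q \<longleftrightarrow> next_bisim m P Q"
proof -
  have "next_bisim m P Q \<longleftrightarrow> agree (Lcb :: ('a, ('i + 'p) + nat) fm set) m P Q" for Q
    \<comment> \<open>Bisimilarity does not mention the index type, so it is instantiated
      explicitly.\<close>
    using assms br_bisim_iff_agree[where 'i = 'i] br_bisim_env_iff_agree[where 'i = 'i]
    by (cases m) simp_all
  then show ?thesis using characteristic_Lcb[of m P] by simp
qed

text \<open>Reflexivity is read off the logical characterisation instead of verifying the clauses
  for the identity.\<close>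

lemma br_bisim_refl: "br_bisim P P"
  by (rule iffD2[OF br_bisim_iff_agree agree_refl])

lemma br_bisim_env_refl: "X \<subseteq> A \<Longrightarrow> br_bisim_env X P P"
  by (rule iffD2[OF br_bisim_env_iff_agree agree_refl])

lemma next_bisim_refl:
  assumes "\<And>X. m = Some X \<Longrightarrow> X \<subseteq> A"
  shows "next_bisim m P P"
  using assms by (cases m) (simp_all add: br_bisim_refl br_bisim_env_refl)

section \<open>Soundness for rooted bisimilarity\<close>

context
  fixes R S
  assumes rooted: "rooted_cbr_bisimulation R S"
begin

lemma rooted_symp: "symp (mode_rel R S m)"
  using rooted unfolding rooted_cbr_bisimulation_def reactive_rel_iff by simp

lemma rooted_R_step:
  "R P Q \<Longrightarrow> \<alpha> \<in> A_tau \<Longrightarrow> P \<midarrow>\<alpha>\<rightarrow> P' \<Longrightarrow> \<exists>Q'. Q \<midarrow>\<alpha>\<rightarrow> Q' \<and> br_bisim P' Q'"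
  using rooted unfolding rooted_cbr_bisimulation_def by simp

lemma rooted_R_imp_S: "R P Q \<Longrightarrow> Y \<subseteq> A \<Longrightarrow> S P Y Q"
  using rooted unfolding rooted_cbr_bisimulation_def by simp

lemma rooted_S_tau:
  "S P X Q \<Longrightarrow> P \<midarrow>Tau\<rightarrow> P' \<Longrightarrow> \<exists>Q'. Q \<midarrow>Tau\<rightarrow> Q' \<and> br_bisim_env X P' Q'"
  using rooted unfolding rooted_cbr_bisimulation_def by simp

lemma rooted_S_vis:
  "S P X Q \<Longrightarrow> a \<in> X \<Longrightarrow> P \<midarrow>Vis a\<rightarrow> P' \<Longrightarrow> \<exists>Q'. Q \<midarrow>Vis a\<rightarrow> Q' \<and> br_bisim P' Q'"
  using rooted unfolding rooted_cbr_bisimulation_def by simp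

lemma rooted_S_idle: "S P X Q \<Longrightarrow> idle P X \<Longrightarrow> R P Q"
  using rooted unfolding rooted_cbr_bisimulation_def by simp

lemma rooted_S_timeout:
  "S P X Q \<Longrightarrow> idle P X \<Longrightarrow> P \<midarrow>Timeout\<rightarrow> P' \<Longrightarrow>
    \<exists>Q'. Q \<midarrow>Timeout\<rightarrow> Q' \<and> br_bisim_env X P' Q'"
  using rooted unfolding rooted_cbr_bisimulation_def by simp

lemma rooted_R_idle:
  assumes "R P Q" "idle P X"
  shows "idle Q X"
proof -
  have "R Q P" using assms(1) sympD[OF rooted_symp[of None]] by simp
  then show ?thesis
    using rooted_R_step assms(2) visible_step_in_A unfolding idle_iff stable_def
    by (metis A_tau_iff(1,2))
qed

text \<open>Rooted clause 2c relates \<open>P\<close> to \<open>Q\<close> itself, with no path in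
  between. In mode \<open>None\<close> the pair is given.\<close>

lemma rooted_idle:
  assumes "mode_rel R S m P Q" "\<And>Y. m = Some Y \<Longrightarrow> idle P Y"
  shows "R P Q"
  using assms rooted_S_idle by (cases m) auto

lemma rooted_tau_match:
  assumes "mode_rel R S m P Q" "P \<midarrow>Tau\<rightarrow> P'"
  shows "\<exists>Q'. Q \<midarrow>Tau\<rightarrow> Q' \<and> next_bisim m P' Q'"
  using assms rooted_R_step[of P Q Tau P'] rooted_S_tau by (cases m) simp_all

lemma rooted_vis_match:
  assumes "mode_rel R S m P Q" "allowed m a P" "P \<midarrow>Vis a\<rightarrow> P'"
  shows "allowed m a Q \<and> (\<exists>Q'. Q \<midarrow>Vis a\<rightarrow> Q' \<and> br_bisim P' Q')"
proof (cases "\<exists>X. m = Some X \<and> a \<in> X")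
  case True
  then obtain X where X: "m = Some X" "a \<in> X" by blast
  then have "S P X Q" using assms(1) by simp
  from rooted_S_vis[OF this X(2) assms(3)] X show ?thesis by simp
next
  case False
  then have "R P Q"
    by (intro rooted_idle[OF assms(1)]) (use assms(2) in auto)
  moreover from this have "allowed m a Q"
    using False assms(2) rooted_R_idle by (cases m) auto
  ultimately show ?thesis
    using rooted_R_step[of P Q "Vis a" P'] assms(3) visible_step_in_A[OF assms(3)] by simp
qed

text \<open>The environment in \<open>m\<close> is exchanged for the set \<open>X\<close> of the
  formula by way of the pair: clause 2c yields it, and clause 1b yields the triple for
  \<open>X\<close>.\<close>

lemma rooted_timeout_match:
  assumes "mode_rel R S m P Q" "idle_in m X P" "X \<subseteq> A" "P \<midarrow>Timeout\<rightarrow> P'"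
  shows "idle_in m X Q \<and> (\<exists>Q'. Q \<midarrow>Timeout\<rightarrow> Q' \<and> br_bisim_env X P' Q')"
proof -
  have "R P Q"
    by (rule rooted_idle[OF assms(1)]) (use assms(2) in auto)
  moreover have "idle P X" using assms(2) by (cases m) auto
  moreover have "S P X Q" using \<open>R P Q\<close> assms(3) rooted_R_imp_S by blast
  ultimately have "\<exists>Q'. Q \<midarrow>Timeout\<rightarrow> Q' \<and> br_bisim_env X P' Q'"
    using rooted_S_timeout assms(4) by blast
  moreover have "idle_in m X Q"
    using assms(2) rooted_R_idle[OF \<open>R P Q\<close>] by (cases m) simp_all
  ultimately show ?thesis by blast
qed

text \<open>The mode stays fixed here: the induction passes only through conjunctions and negations,
  and whatever lies below a diamond is in \<open>Lcb\<close> and handled by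
  \<open>next_bisim_sem\<close>.\<close>

lemma rooted_sem_imp:
  assumes "\<psi> \<in> Lcrb" "mode_rel R S m P Q" "sem \<psi> m P"
  shows "sem \<psi> m Q"
  using assms
proof (induction \<psi> arbitrary: P Q rule: Lcrb.induct)
  case (Neg \<psi>)
  then show ?case using sympD[OF rooted_symp] unfolding sem.simps by blast
next
  case (Dia \<alpha> \<phi>)
  from \<open>\<alpha> \<in> A_tau\<close> show ?case
  proof (cases rule: A_tau_cases)
    case 1
    then show ?thesis
      using Dia.prems rooted_tau_match next_bisim_sem[OF \<open>\<phi> \<in> Lcb\<close>] unfolding 1 sem_Dia_Tau
      by blast
  next
    case (2 a)
    then show ?thesis
      using Dia.prems rooted_vis_match next_bisim_sem[OF \<open>\<phi> \<in> Lcb\<close>, of None]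
      unfolding 2 sem_Dia_Vis next_bisim_simps by blast
  qed
next
  case (TDia X \<phi>)
  then show ?case
    using rooted_timeout_match[OF TDia.prems(1) _ \<open>X \<subseteq> A\<close>]
      next_bisim_sem[OF \<open>\<phi> \<in> Lcb\<close>, of "Some X"]
    unfolding sem_TDia next_bisim_simps by blast
qed auto

lemma rooted_sem: "\<psi> \<in> Lcrb \<Longrightarrow> mode_rel R S m P Q \<Longrightarrow> sem \<psi> m P \<longleftrightarrow> sem \<psi> m Q"
  using rooted_sem_imp sympD[OF rooted_symp] by blast

end

section \<open>Completeness for rooted bisimilarity\<close>

context
  fixes L :: "('a, ('i + 'p) + nat) fm set"
  defines L_def: "L \<equiv> Lcrb"
begin

lemma rooted_agree_tau_match:
  assumes "agree L m P Q" "P \<midarrow>Tau\<rightarrow> P'" "\<And>X. m = Some X \<Longrightarrow> X \<subseteq> A"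
  shows "\<exists>Q'. Q \<midarrow>Tau\<rightarrow> Q' \<and> next_bisim m P' Q'"
proof -
  obtain \<chi> :: "('a, ('i + 'p) + nat) fm"
    where \<chi>: "\<chi> \<in> Lcb" "\<And>Q. sem \<chi> m Q \<longleftrightarrow> next_bisim m P' Q"
    using characteristic_next_bisim assms(3) by blast
  then have "Dia Tau \<chi> \<in> L" by (simp add: L_def Lcrb.Dia)
  moreover have "sem (Dia Tau \<chi>) m P"
    unfolding sem_Dia_Tau \<chi>(2) using assms(2) next_bisim_refl[OF assms(3)] by blast
  ultimately have "sem (Dia Tau \<chi>) m Q" using agreeD[OF assms(1)] by blast
  then show ?thesis unfolding sem_Dia_Tau \<chi>(2) .
qed

lemma rooted_agree_vis_match:
  assumes "agree L m P Q" "allowed m a P" "P \<midarrow>Vis a\<rightarrow> P'"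
  shows "allowed m a Q \<and> (\<exists>Q'. Q \<midarrow>Vis a\<rightarrow> Q' \<and> br_bisim P' Q')"
proof -
  obtain \<chi> :: "('a, ('i + 'p) + nat) fm"
    where \<chi>: "\<chi> \<in> Lcb" "\<And>Q. sem \<chi> None Q \<longleftrightarrow> br_bisim P' Q"
    using characteristic_next_bisim[of None P'] by auto
  then have "Dia (Vis a) \<chi> \<in> L"
    using visible_step_in_A[OF assms(3)] by (simp add: L_def Lcrb.Dia)
  moreover have "sem (Dia (Vis a) \<chi>) m P"
    unfolding sem_Dia_Vis \<chi>(2) using assms(2,3) br_bisim_refl by blast
  ultimately have "sem (Dia (Vis a) \<chi>) m Q" using agreeD[OF assms(1)] by blast
  then show ?thesis unfolding sem_Dia_Vis \<chi>(2) .
qed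

lemma rooted_agree_timeout_match:
  assumes "agree L m P Q" "idle_in m X P" "X \<subseteq> A" "P \<midarrow>Timeout\<rightarrow> P'"
  shows "idle_in m X Q \<and> (\<exists>Q'. Q \<midarrow>Timeout\<rightarrow> Q' \<and> br_bisim_env X P' Q')"
proof -
  obtain \<chi> :: "('a, ('i + 'p) + nat) fm"
    where \<chi>: "\<chi> \<in> Lcb" "\<And>Q. sem \<chi> (Some X) Q \<longleftrightarrow> br_bisim_env X P' Q"
    using characteristic_next_bisim[of "Some X" P'] assms(3) by auto
  then have "TDia X \<chi> \<in> L" using assms(3) by (simp add: L_def Lcrb.TDia)
  moreover have "sem (TDia X \<chi>) m P"
    unfolding sem_TDia \<chi>(2) using assms(2-4) br_bisim_env_refl by blast
  ultimately have "sem (TDia X \<chi>) m Q" using agreeD[OF assms(1)] by blast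
  then show ?thesis unfolding sem_TDia \<chi>(2) .
qed

text \<open>The last assumption makes the steps of \<open>Q\<close> with labels in \<open>X\<close>
  observable in mode \<open>m\<close>, so \<open>P\<close> would have to match them. It is immediate
  for \<open>None\<close> and for \<open>Some X\<close>, the two modes in which the lemma is
  applied.\<close>

lemma rooted_agree_idle:
  assumes "agree L m P Q" "idle P X" "\<And>a. a \<in> X \<Longrightarrow> allowed m a Q"
  shows "idle Q X"
proof -
  have "Dia Tau TT \<in> L" by (simp add: L_def Lcrb.Dia Lcb.TT)
  then have "stable Q"
    using agreeD[OF assms(1)] idle_stable[OF assms(2)] by (fastforce simp: sem_Dia_Tau stable_def)
  then show ?thesis
    using rooted_agree_vis_match[OF agree_sym[OF assms(1)] assms(3)] assms(2)
    unfolding idle_iff by blast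
qed

text \<open>For clause 1b of the rooted definition; targets of steps are compared by the
  bisimilarities already characterised.\<close>

lemma rooted_agree_imp_sem_env:
  assumes "\<psi> \<in> L" "agree L None P Q" "Y \<subseteq> A" "sem \<psi> (Some Y) P"
  shows "sem \<psi> (Some Y) Q"
  using assms unfolding L_def
proof (induction \<psi> arbitrary: P Q rule: Lcrb.induct)
  case (Neg \<psi>)
  then show ?case using agree_sym[of Lcrb] unfolding sem.simps by blast
next
  case (Dia \<alpha> \<phi>)
  note agree = Dia.prems(1)[folded L_def]
  from \<open>\<alpha> \<in> A_tau\<close> show ?case
  proof (cases rule: A_tau_cases)
    case 1
    then obtain P' where "P \<midarrow>Tau\<rightarrow> P'" "sem \<phi> (Some Y) P'"
      using Dia.prems by (auto simp: sem_Dia_Tau)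
    moreover from this obtain Q' where "Q \<midarrow>Tau\<rightarrow> Q'" "br_bisim P' Q'"
      using rooted_agree_tau_match[OF agree] by auto
    \<comment> \<open>The targets are bisimilar without environment, and
      \<open>Y \<subseteq> A\<close> carries this over to the mode in which \<open>\<phi>\<close> is
      evaluated.\<close>
    ultimately show ?thesis
      using br_bisim_imp_br_bisim_env[OF _ \<open>Y \<subseteq> A\<close>] next_bisim_sem[OF \<open>\<phi> \<in> Lcb\<close>, of "Some Y"]
      unfolding 1 sem_Dia_Tau next_bisim_simps by blast
  next
    case (2 a)
    then obtain P' where P': "P \<midarrow>Vis a\<rightarrow> P'" "sem \<phi> None P'" "a \<in> Y \<or> idle P Y"
      using Dia.prems by (auto simp: sem_Dia_Vis)
    moreover from this obtain Q' where "Q \<midarrow>Vis a\<rightarrow> Q'" "br_bisim P' Q'"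
      using rooted_agree_vis_match[OF agree] by auto
    moreover have "a \<in> Y \<or> idle Q Y"
      using P'(3) rooted_agree_idle[OF agree] by auto
    ultimately show ?thesis
      using next_bisim_sem[OF \<open>\<phi> \<in> Lcb\<close>, of None]
      unfolding 2 sem_Dia_Vis next_bisim_simps allowed_simps by blast
  qed
next
  case (TDia X \<phi>)
  note agree = TDia.prems(1)[folded L_def]
  obtain P' where P': "P \<midarrow>Timeout\<rightarrow> P'" "sem \<phi> (Some X) P'" "idle P X" "idle P Y"
    using TDia.prems by (auto simp: sem_TDia)
  moreover from this obtain Q' where "Q \<midarrow>Timeout\<rightarrow> Q'" "br_bisim_env X P' Q'"
    using rooted_agree_timeout_match[OF agree _ \<open>X \<subseteq> A\<close>] by auto
  moreover have "idle Q X" "idle Q Y"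
    using P'(3,4) rooted_agree_idle[OF agree] by auto
  ultimately show ?case
    using next_bisim_sem[OF \<open>\<phi> \<in> Lcb\<close>, of "Some X"]
    unfolding sem_TDia next_bisim_simps idle_in_simps by blast
qed auto

lemma rooted_agree_imp_agree_env:
  assumes "agree L None P Q" "Y \<subseteq> A"
  shows "agree L (Some Y) P Q"
  using rooted_agree_imp_sem_env[OF _ assms]
    rooted_agree_imp_sem_env[OF _ agree_sym[OF assms(1)] assms(2)]
  unfolding agree_def[of L "Some Y"] by blast

lemma rooted_agree_env_imp_sem:
  assumes "\<psi> \<in> L" "agree L (Some X) P Q" "idle P X" "idle Q X" "sem \<psi> None P"
  shows "sem \<psi> None Q"
  using assms unfolding L_def
proof (induction \<psi> arbitrary: P Q rule: Lcrb.induct)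
  case (Neg \<psi>)
  then show ?case using agree_sym[of Lcrb] unfolding sem.simps by blast
next
  case (Dia \<alpha> \<phi>)
  note agree = Dia.prems(1)[folded L_def]
  from \<open>\<alpha> \<in> A_tau\<close> show ?case
  proof (cases rule: A_tau_cases)
    case 1
    \<comment> \<open>As \<open>P\<close> is stable, the diamond cannot hold at
      \<open>P\<close>.\<close>
    then show ?thesis
      using Dia.prems idle_stable[of P X] by (simp add: sem_Dia_Tau stable_def)
  next
    case (2 a)
    then obtain P' where P': "P \<midarrow>Vis a\<rightarrow> P'" "sem \<phi> None P'"
      using Dia.prems by (auto simp: sem_Dia_Vis)
    moreover from this obtain Q' where "Q \<midarrow>Vis a\<rightarrow> Q'" "br_bisim P' Q'"
      using rooted_agree_vis_match[OF agree] \<open>idle P X\<close> by auto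
    ultimately show ?thesis
      using next_bisim_sem[OF \<open>\<phi> \<in> Lcb\<close>, of None] allowed_simps(1)
      unfolding 2 sem_Dia_Vis next_bisim_simps by blast
  qed
next
  case (TDia Y \<phi>)
  note agree = TDia.prems(1)[folded L_def]
  obtain P' where P': "P \<midarrow>Timeout\<rightarrow> P'" "sem \<phi> (Some Y) P'" "idle P Y"
    using TDia.prems by (auto simp: sem_TDia)
  moreover from this obtain Q' where "Q \<midarrow>Timeout\<rightarrow> Q'" "br_bisim_env Y P' Q'" "idle Q Y"
    using rooted_agree_timeout_match[OF agree _ \<open>Y \<subseteq> A\<close>] \<open>idle P X\<close> by auto
  ultimately show ?case
    using next_bisim_sem[OF \<open>\<phi> \<in> Lcb\<close>, of "Some Y"]
    unfolding sem_TDia next_bisim_simps idle_in_simps by blast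
qed auto

lemma rooted_agree_env_idle:
  assumes "agree L (Some X) P Q" "idle P X"
  shows "agree L None P Q"
proof -
  have "idle Q X" using rooted_agree_idle[OF assms] by simp
  then show ?thesis
    using rooted_agree_env_imp_sem[OF _ assms]
      rooted_agree_env_imp_sem[OF _ agree_sym[OF assms(1)] _ assms(2)]
    unfolding agree_def[of L None] by blast
qed

lemma agree_rooted_cbr_bisimulation:
  "rooted_cbr_bisimulation (agree L None) (\<lambda>P X Q. X \<subseteq> A \<and> agree L (Some X) P Q)"
    (is "rooted_cbr_bisimulation ?R ?S")
  unfolding rooted_cbr_bisimulation_def
proof (intro conjI allI impI ballI)
  show "reactive_rel ?R ?S"
    unfolding reactive_rel_def using agree_sym by blast
next
  fix P Q \<alpha> P' assume "?R P Q" "\<alpha> \<in> A_tau" "P \<midarrow>\<alpha>\<rightarrow> P'"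
  then show "\<exists>Q'. Q \<midarrow>\<alpha>\<rightarrow> Q' \<and> br_bisim P' Q'"
    using rooted_agree_tau_match[of None P Q P'] rooted_agree_vis_match[of None P Q _ P']
    by (auto elim!: A_tau_cases)
next
  fix P Q Y assume "?R P Q" "Y \<subseteq> A"
  then show "Y \<subseteq> A" "agree L (Some Y) P Q" using rooted_agree_imp_agree_env by blast+
next
  fix P X Q P' assume "?S P X Q" "P \<midarrow>Tau\<rightarrow> P'"
  then show "\<exists>Q'. Q \<midarrow>Tau\<rightarrow> Q' \<and> br_bisim_env X P' Q'"
    using rooted_agree_tau_match[of "Some X" P Q P'] by simp
next
  fix P X Q a P' assume "?S P X Q" "a \<in> X" "P \<midarrow>Vis a\<rightarrow> P'"
  then show "\<exists>Q'. Q \<midarrow>Vis a\<rightarrow> Q' \<and> br_bisim P' Q'"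
    using rooted_agree_vis_match[of "Some X" P Q a P'] by simp
next
  fix P X Q assume "?S P X Q" "idle P X"
  then show "?R P Q" using rooted_agree_env_idle by blast
next
  fix P X Q P' assume "?S P X Q" "idle P X \<and> P \<midarrow>Timeout\<rightarrow> P'"
  then show "\<exists>Q'. Q \<midarrow>Timeout\<rightarrow> Q' \<and> br_bisim_env X P' Q'"
    using rooted_agree_timeout_match[of "Some X" P Q X P'] by simp
qed

lemma rbr_bisim_iff_agree: "rbr_bisim P Q \<longleftrightarrow> agree L None P Q"
proof
  assume "rbr_bisim P Q"
  then obtain R S where "rooted_cbr_bisimulation R S" "R P Q" unfolding rbr_bisim_def by blast
  then show "agree L None P Q"
    unfolding agree_def L_def by (intro ballI rooted_sem[of R S]) simp_all
next
  assume "agree L None P Q"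
  then show "rbr_bisim P Q" using agree_rooted_cbr_bisimulation unfolding rbr_bisim_def by blast
qed

lemma rbr_bisim_env_iff_agree:
  assumes "X \<subseteq> A"
  shows "rbr_bisim_env X P Q \<longleftrightarrow> agree L (Some X) P Q"
proof
  assume "rbr_bisim_env X P Q"
  then obtain R S where "rooted_cbr_bisimulation R S" "S P X Q"
    unfolding rbr_bisim_env_def by blast
  then show "agree L (Some X) P Q"
    unfolding agree_def L_def by (intro ballI rooted_sem[of R S]) simp_all
next
  assume "agree L (Some X) P Q"
  then show "rbr_bisim_env X P Q"
    using agree_rooted_cbr_bisimulation assms unfolding rbr_bisim_env_def by blast
qed

end

end

theorem theorem11:
  fixes A :: "'a set"
    and step :: "'p \<Rightarrow> 'a act \<Rightarrow> 'p \<Rightarrow> bool"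
    and P Q :: 'p
    and X :: "'a set"
  assumes "lts A step"
    and "X \<subseteq> A"
  shows
    "(lts.br_bisim A step P Q \<longleftrightarrow>
        (\<forall>\<phi> \<in> (lts.Lcb A :: ('a, ('i + 'p) + nat) fm set).
           lts.sat A step P \<phi> \<longleftrightarrow> lts.sat A step Q \<phi>)) \<and>
     (lts.br_bisim_env A step X P Q \<longleftrightarrow>
        (\<forall>\<phi> \<in> (lts.Lcb A :: ('a, ('i + 'p) + nat) fm set).
           lts.sat_env A step X P \<phi> \<longleftrightarrow> lts.sat_env A step X Q \<phi>)) \<and>
     (lts.rbr_bisim A step P Q \<longleftrightarrow>
        (\<forall>\<psi> \<in> (lts.Lcrb A :: ('a, ('i + 'p) + nat) fm set).
           lts.sat A step P \<psi> \<longleftrightarrow> lts.sat A step Q \<psi>)) \<and>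
     (lts.rbr_bisim_env A step X P Q \<longleftrightarrow>
        (\<forall>\<psi> \<in> (lts.Lcrb A :: ('a, ('i + 'p) + nat) fm set).
           lts.sat_env A step X P \<psi> \<longleftrightarrow> lts.sat_env A step X Q \<psi>))"
proof -
  interpret lts A step by fact
  show ?thesis
    \<comment> \<open>Each right-hand side folds into \<open>agree\<close>, in mode
      \<open>None\<close> or \<open>Some X\<close>, which is the form of the four
      characterisations.\<close>
    unfolding sat_def sat_env_def agree_def[symmetric]
    by (intro conjI br_bisim_iff_agree br_bisim_env_iff_agree rbr_bisim_iff_agree
        rbr_bisim_env_iff_agree \<open>X \<subseteq> A\<close>)
qed

end
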